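(* Let $\ell$ be a positive integer, let $X=\mathcal H_\ell$ be the Hirzebruch surface over $\mathbb K=\mathbb F_q$, and let $c_1,c_2$ be positive integers dividing $q-1$ with $c_1\le \ell c_2$. Let $L$ be the lattice with basis $\{c_1\mathbf u_1,c_2\mathbf u_2\}$ and let $Y=V_{X(\mathbb F_q)}(I_L)$, a subgroup of the torus $T_X(\mathbb F_q)$. Let $\alpha=(c,d)\in\mathbb N\beta=\mathbb N^2$. Let $b$ be the greatest non-negative integer with $c-b\ell\ge0$ and $d-b\ge0$, and, when $c\ge c_1$, let $b'$ be the greatest non-negative integer with $c-b'\ell\ge c_1-1$ and $d-b'\ge0$. Then the dimension $K$ of the toric code $\mathcal C_{\alpha,Y}$ is $$K=\begin{cases}(b+1)[c+1-b\ell/2], & \text{if } c<c_1 \text{ and } b\le c_2-1,\\ c_2[c+1-(c_2-1)\ell/2], & \text{if } c<c_1\text{ and } c_2-1<b,\\ c_1(b'+1)+(b-b')[c+1-\ell(b+b'+1)/2], & \text{if } c\ge c_1 \text{ and } b'\le b<c_2-1,\\ c_1(b'+1)+(c_2-1-b')[c+1-\ell(c_2+b')/2], & \text{if } c\ge c_1\text{ and } b'<c_2-1\le b,\\ c_1c_2, & \text{if } c\ge c_1 \text{ and } b'\ge c_2-1,\end{cases}$$ and its minimum distance is $$\delta(\mathcal C_{\alpha,Y})=\begin{cases}c_2[c_1-c], & \text{if } c<c_1 \text{ and } b\le c_2-1,\\ c_2[c_1-c], & \text{if } c<c_1\text{ and } c_2-1<b,\\ c_2-b', & \text{if } c\ge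 c_1 \text{ and } b'\le b<c_2-1,\\ c_2-b', & \text{if } c\ge c_1\text{ and } b'<c_2-1\le b,\\ 1, & \text{if } c\ge c_1 \text{ and } b'\ge c_2-1.\end{cases}$$
   Context: The Hirzebruch surface $\mathcal H_\ell$ is the toric surface of the complete fan in $\mathbb R^2$ with rays generated by $\mathbf v_1=(1,0)$, $\mathbf v_2=(0,1)$, $\mathbf v_3=(-1,\ell)$, $\mathbf v_4=(0,-1)$. Put $\mathbf u_1=(1,0,-1,0)$, $\mathbf u_2=(0,1,\ell,-1)\in\mathbb Z^4$, $\beta=\begin{bmatrix}1&0&1&\ell\\0&1&0&1\end{bmatrix}$, and $L_\beta=\ker\beta=\langle\mathbf u_1,\mathbf u_2\rangle$. The Cox ring $S=\mathbb F_q[x_1,x_2,x_3,x_4]$ is $\mathbb Z^2$-graded by $\deg x_1=\deg x_3=(1,0)$, $\deg x_2=(0,1)$, $\deg x_4=(\ell,1)$; $S_\alpha$ is the $\mathbb F_q$-span of the monomials of degree $\alpha$. $\mathbb N=\{0,1,2,\dots\}$ and $\mathbb N\beta$ is the semigroup generated by the columns of $\beta$. For $L\subseteq L_\beta$, $I_L=\langle \mathbf x^{\mathbf m^+}-\mathbf x^{\mathbf m^-} : \mathbf m=\mathbf m^+-\mathbf m^-\in L\rangle\subseteq S$, with $\mathbf m^\pm\in\mathbb N^4$ the positive and negative parts of $\mathbf m$. Let $G=\{(t_1,t_2,t_1,t_1^\ell t_2): t_1,t_2\in\overline{\mathbb F}_q^*\}$ and $B=\langle x_1x_2,x_2x_3,x_3x_4,x_4x_1\rangle$.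 $X(\mathbb F_q)$ is the set of orbits $[P]=G\cdot P$ with $P\in\mathbb F_q^4\setminus V(B)$, and $T_X(\mathbb F_q)$ is the group of orbits $[P]$ with $P\in(\mathbb F_q^* )^4$ under coordinatewise multiplication. $V_{X(\mathbb F_q)}(I_L)=\{[P]\in X(\mathbb F_q): F(P)=0\text{ for all homogeneous }F\in I_L\}$. For a subset $Y=\{[P_1],\dots,[P_N]\}$ of $T_X(\mathbb F_q)$, with chosen representatives $P_i\in(\mathbb F_q^* )^4$, the generalized toric code $\mathcal C_{\alpha,Y}\subseteq\mathbb F_q^N$ is the image of the evaluation map $S_\alpha\to\mathbb F_q^N$, $F\mapsto(F(P_1),\dots,F(P_N))$. Its dimension is $K=\dim_{\mathbb F_q}\mathcal C_{\alpha,Y}$ and its minimum distance $\delta(\mathcal C_{\alpha,Y})$ is the minimum number of nonzero components of a nonzero vector of $\mathcal C_{\alpha,Y}$ (these do not depend on the choice of representatives). *)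

theory Defs
  imports
    "HOL-Analysis.Analysis"
    "HOL-Algebra.Algebraic_Closure_Type"
    "HOL-Library.Poly_Mapping"
    "HOL-Library.Function_Algebras"
begin

text \<open>
  The field with \<open>q\<close> elements is a type \<open>'a :: {field, finite}\<close>, so that \<open>q = CARD('a)\<close>.
  The Cox ring is the monoid algebra of \<open>nat ^ 4\<close>: a polynomial maps exponent vectors to
  coefficients, and its multiplication is the convolution product of \<open>Poly_Mapping\<close>.
\<close>

type_synonym 'a cox = "(nat ^ 4) \<Rightarrow>\<^sub>0 'a"

lemma vector_4 [simp]:
  "(vector [w, x, y, z] :: 'a::zero ^ 4) $ 1 = w"
  "(vector [w, x, y, z] :: 'a::zero ^ 4) $ 2 = x"
  "(vector [w, x, y, z] :: 'a::zero ^ 4) $ 3 = y"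
  "(vector [w, x, y, z] :: 'a::zero ^ 4) $ 4 = z"
  unfolding vector_def by simp_all

definition eval_cox :: "'a::comm_ring_1 cox \<Rightarrow> 'a ^ 4 \<Rightarrow> 'a" where
  "eval_cox F P =
     (\<Sum>m\<in>Poly_Mapping.keys F. Poly_Mapping.lookup F m * (\<Prod>i\<in>UNIV. (P $ i) ^ (m $ i)))"

definition xmonom :: "nat ^ 4 \<Rightarrow> 'a::comm_ring_1 cox" where
  "xmonom m = Poly_Mapping.single m 1"

definition ideal_generated :: "'a::comm_ring_1 cox set \<Rightarrow> 'a cox set" where
  "ideal_generated A = Modules.module.span (*) A"


subsection \<open>The grading of the Cox ring\<close>

definition \<beta> :: "nat \<Rightarrow> int ^ 4 ^ 2" where
  "\<beta> l = vector [vector [1, 0, 1, int l], vector [0, 1, 0, 1]]"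

definition u1 :: "int ^ 4" where
  "u1 = vector [1, 0, -1, 0]"

definition u2 :: "nat \<Rightarrow> int ^ 4" where
  "u2 l = vector [0, 1, int l, -1]"

text \<open>The degree of the variable \<open>x\<^sub>i\<close> is the \<open>i\<close>-th column of \<open>\<beta>\<close>.\<close>

definition mdegree :: "nat \<Rightarrow> nat ^ 4 \<Rightarrow> int ^ 2" where
  "mdegree l m = \<beta> l *v (\<chi> i. int (m $ i))"

definition graded_piece :: "nat \<Rightarrow> int ^ 2 \<Rightarrow> 'a::comm_ring_1 cox set" where
  "graded_piece l \<alpha> = {F. \<forall>m\<in>Poly_Mapping.keys F. mdegree l m = \<alpha>}"

definition homogeneous :: "nat \<Rightarrow> 'a::comm_ring_1 cox \<Rightarrow> bool" where
  "homogeneous l F \<longleftrightarrow> (\<exists>\<alpha>. F \<in> graded_piece l \<alpha>)"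


subsection \<open>Lattice ideals\<close>

definition pos_part :: "int ^ 4 \<Rightarrow> nat ^ 4" where
  "pos_part m = (\<chi> i. nat (m $ i))"

definition neg_part :: "int ^ 4 \<Rightarrow> nat ^ 4" where
  "neg_part m = (\<chi> i. nat (- (m $ i)))"

definition lattice_ideal :: "(int ^ 4) set \<Rightarrow> 'a::comm_ring_1 cox set" where
  "lattice_ideal L = ideal_generated {xmonom (pos_part m) - xmonom (neg_part m) | m. m \<in> L}"


subsection \<open>Rational points of the Hirzebruch surface\<close>

definition G :: "nat \<Rightarrow> ('a::field alg_closure ^ 4) set" where
  "G l = {vector [t1, t2, t1, t1 ^ l * t2] | t1 t2. t1 \<noteq> 0 \<and> t2 \<noteq> 0}"

text \<open>Orbits are taken over the algebraic closure, also for points with coordinates in \<open>'a\<close>.\<close>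

definition orbit :: "nat \<Rightarrow> 'a::field ^ 4 \<Rightarrow> ('a alg_closure ^ 4) set" where
  "orbit l P = {g * (\<chi> i. to_ac (P $ i)) | g. g \<in> G l}"

definition irrelevant_ideal :: "'a::comm_ring_1 cox set" where
  "irrelevant_ideal = ideal_generated
     {xmonom (vector [1, 1, 0, 0]), xmonom (vector [0, 1, 1, 0]),
      xmonom (vector [0, 0, 1, 1]), xmonom (vector [1, 0, 0, 1])}"

definition affine_zeros :: "'a::comm_ring_1 cox set \<Rightarrow> ('a ^ 4) set" where
  "affine_zeros I = {P. \<forall>F\<in>I. eval_cox F P = 0}"

definition hirzebruch_points :: "nat \<Rightarrow> ('a::field alg_closure ^ 4) set set" where
  "hirzebruch_points l = {orbit l P | P :: 'a ^ 4. P \<notin> affine_zeros irrelevant_ideal}"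

text \<open>
  Vanishing of a homogeneous polynomial does not depend on the representative of a point
  of \<^const>\<open>hirzebruch_points\<close>.
\<close>

definition zero_locus :: "nat \<Rightarrow> 'a::field cox set \<Rightarrow> ('a alg_closure ^ 4) set set" where
  "zero_locus l I = {A \<in> hirzebruch_points l. \<exists>P :: 'a ^ 4. A = orbit l P \<and>
     (\<forall>F\<in>I. homogeneous l F \<longrightarrow> eval_cox F P = 0)}"

definition torus_coords :: "('a::field ^ 4) set" where
  "torus_coords = {P. \<forall>i. P $ i \<noteq> 0}"

text \<open>
  The elementwise product of the orbits of two points of the torus is the orbit of the
  coordinatewise product of these points.
\<close>

definition torus :: "nat \<Rightarrow> ('a::field alg_closure ^ 4) set monoid" where
  "torus l = \<lparr>carrier = {orbit l P | P :: 'a ^ 4. P \<in> torus_coords},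
              monoid.mult = (\<lambda>A B. {x * y | x y. x \<in> A \<and> y \<in> B}),
              one = orbit l (1 :: 'a ^ 4)\<rparr>"


subsection \<open>Generalized toric codes\<close>

definition representatives ::
  "nat \<Rightarrow> ('a::field alg_closure ^ 4) set set \<Rightarrow> nat \<Rightarrow> (nat \<Rightarrow> 'a ^ 4) \<Rightarrow> bool" where
  "representatives l Y N P \<longleftrightarrow>
     (\<forall>i<N. P i \<in> torus_coords) \<and> bij_betw (\<lambda>i. orbit l (P i)) {..<N} Y"

text \<open>
  Words of length \<open>N\<close> are functions on \<open>nat\<close> that vanish outside \<open>{..<N}\<close>; the length depends
  on the set of points and hence cannot be a type.
\<close>

definition toric_code ::
  "nat \<Rightarrow> int ^ 2 \<Rightarrow> nat \<Rightarrow> (nat \<Rightarrow> 'a::field ^ 4) \<Rightarrow> (nat \<Rightarrow> 'a) set" where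
  "toric_code l \<alpha> N P =
     (\<lambda>F i. if i < N then eval_cox F (P i) else 0) ` graded_piece l \<alpha>"

definition code_dim :: "(nat \<Rightarrow> 'a::field) set \<Rightarrow> nat" where
  "code_dim C = Vector_Spaces.vector_space.dim (\<lambda>a v i. a * v i) C"

definition min_distance :: "(nat \<Rightarrow> 'a::field) set \<Rightarrow> nat" where
  "min_distance C = (LEAST w. \<exists>v\<in>C. v \<noteq> 0 \<and> w = card {i. v i \<noteq> 0})"

end

theory Submission
  imports Defs
begin

text \<open>
  The Laurent monomials \<open>s = x\<^sub>1 / x\<^sub>3\<close> and \<open>t = x\<^sub>4 / (x\<^sub>2 x\<^sub>3\<^bsup>l\<^esup>)\<close> are coordinates of the torus orbits of
  the Hirzebruch surface (lemma \<open>orbit_eq_iff\<close>). The lattice ideal imposes \<open>s\<^bsup>c1\<^esup> = 1\<close> and \<open>t\<^bsup>c2\<^esup> = 1\<close>, and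
  its zeros on the surface all lie in the torus; so \<open>Y\<close> is the subgroup \<open>\<mu>\<^bsub>c1\<^esub> \<times> \<mu>\<^bsub>c2\<^esub>\<close>
  (lemma \<open>zero_locus_lattice_ideal\<close>), a grid with \<open>c1 c2\<close> points since \<open>c1\<close> and \<open>c2\<close> divide \<open>q - 1\<close>.

  On a torus point the monomials of degree \<open>(c, d)\<close> are, up to a common nonzero factor, the monomials
  \<open>s\<^bsup>k\<^esup> t\<^bsup>j\<^esup>\<close> with \<open>j \<le> b\<close> and \<open>k \<le> c - l j\<close>. Reducing the exponents modulo \<open>c1\<close> and \<open>c2\<close> leaves the staircase
  \<open>j \<le> min b (c2 - 1)\<close>, \<open>k \<le> r j = min (c - l j) (c1 - 1)\<close>. A polynomial supported on it with degree \<open>J\<close>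
  in \<open>t\<close> has a leading coefficient of degree at most \<open>r J\<close> in \<open>s\<close>, so it is nonzero in at least
  \<open>(c1 - r J) (c2 - J)\<close> points of the grid (lemma \<open>card_nonroots_eval2_ge\<close>). This number is positive;
  hence the monomials of the staircase are linearly independent on the grid, and the dimension is the
  size of the staircase, a sum of \<open>c1\<close>'s and of an arithmetic progression.

  The minimum distance is at least the minimum of \<open>(c1 - r J) (c2 - J)\<close> over the rows \<open>J\<close>. For \<open>c < c1\<close>
  the condition \<open>c1 \<le> l c2\<close> puts this minimum at \<open>J = 0\<close>; for \<open>c \<ge> c1\<close> it is at the last row with
  \<open>r J = c1 - 1\<close> (lemmas \<open>weight_bound_lt\<close> and \<open>weight_bound_ge\<close>). Products of linear factors in \<open>s\<close> and
  in \<open>t\<close> attain it (lemma \<open>exists_word_of_weight\<close>).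
\<close>

section \<open>Evaluation of Cox polynomials and zeros of ideals\<close>

lemma eval_cox_eq_sum:
  assumes "finite S" "Poly_Mapping.keys F \<subseteq> S"
  shows "eval_cox F P = (\<Sum>m\<in>S. Poly_Mapping.lookup F m * (\<Prod>i\<in>UNIV. (P $ i) ^ (m $ i)))"
  unfolding eval_cox_def using assms
  by (intro sum.mono_neutral_left) (auto simp: in_keys_iff)

lemma eval_cox_0 [simp]: "eval_cox 0 P = 0"
  by (simp add: eval_cox_def)

lemma eval_cox_add: "eval_cox (F + F') P = eval_cox F P + eval_cox F' P"
proof -
  let ?S = "Poly_Mapping.keys F \<union> Poly_Mapping.keys F'"
  have "Poly_Mapping.keys (F + F') \<subseteq> ?S"
    by (rule Poly_Mapping.keys_add)
  then show ?thesis
    using eval_cox_eq_sum[of ?S F P] eval_cox_eq_sum[of ?S F' P] eval_cox_eq_sum[of ?S "F + F'" P]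
    by (simp add: lookup_add distrib_right sum.distrib)
qed

lemma eval_cox_diff: "eval_cox (F - F') P = eval_cox F P - eval_cox F' P"
  using eval_cox_add[of "F - F'" F' P] by simp

lemma eval_cox_sum: "eval_cox (\<Sum>x\<in>A. f x) P = (\<Sum>x\<in>A. eval_cox (f x) P)"
  by (induction A rule: infinite_finite_induct) (simp_all add: eval_cox_add)

lemma eval_cox_single:
  "eval_cox (Poly_Mapping.single m a) P = a * (\<Prod>i\<in>UNIV. (P $ i) ^ (m $ i))"
  by (simp add: eval_cox_def)

lemma eval_cox_xmonom: "eval_cox (xmonom m) P = (\<Prod>i\<in>UNIV. (P $ i) ^ (m $ i))"
  by (simp add: xmonom_def eval_cox_single)

lemma cox_eq_sum_single:
  fixes F :: "'a::comm_ring_1 cox"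
  shows "F = (\<Sum>m\<in>Poly_Mapping.keys F. Poly_Mapping.single m (Poly_Mapping.lookup F m))"
  by (rule poly_mapping_eqI) (auto simp: lookup_sum lookup_single when_def in_keys_iff)

text \<open>
  Additivity in both factors reduces this to monomials, where it is the law of exponents.
  It is the reason why the zeros of an ideal are the common zeros of its generators.
\<close>

lemma eval_cox_mult: "eval_cox (F * F') P = eval_cox F P * eval_cox F' P"
proof -
  let ?K = "Poly_Mapping.keys F" and ?K' = "Poly_Mapping.keys F'"
  let ?c = "Poly_Mapping.lookup F" and ?c' = "Poly_Mapping.lookup F'"
  have "F * F' = (\<Sum>m\<in>?K. Poly_Mapping.single m (?c m)) * (\<Sum>n\<in>?K'. Poly_Mapping.single n (?c' n))"
    by (rule arg_cong2[where f = "(*)", OF cox_eq_sum_single cox_eq_sum_single])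
  also have "\<dots> = (\<Sum>m\<in>?K. \<Sum>n\<in>?K'. Poly_Mapping.single (m + n) (?c m * ?c' n))"
    by (simp add: sum_product mult_single)
  finally have "eval_cox (F * F') P =
      (\<Sum>m\<in>?K. \<Sum>n\<in>?K'. ?c m * (\<Prod>i\<in>UNIV. P $ i ^ m $ i) * (?c' n * (\<Prod>i\<in>UNIV. P $ i ^ n $ i)))"
    by (simp add: eval_cox_sum eval_cox_single power_add prod.distrib mult_ac)
  then show ?thesis
    by (simp add: eval_cox_def sum_product)
qed

lemma module_mult: "Modules.module ((*) :: 'a::comm_ring_1 \<Rightarrow> 'a \<Rightarrow> 'a)"
  by unfold_locales (auto simp: algebra_simps)

lemma ideal_generated_superset: "A \<subseteq> ideal_generated A"
  unfolding ideal_generated_def by (rule Modules.module.span_superset[OF module_mult])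

lemma eval_cox_ideal_generated:
  assumes "F \<in> ideal_generated A" "\<And>F. F \<in> A \<Longrightarrow> eval_cox F P = 0"
  shows "eval_cox F P = 0"
  using assms(1) unfolding ideal_generated_def
proof (induction rule: Modules.module.span_induct_alt[OF module_mult, consumes 1])
  case (2 c x y)
  then show ?case using assms(2) by (simp add: eval_cox_add eval_cox_mult)
qed simp

lemma affine_zeros_ideal_generated:
  "affine_zeros (ideal_generated A) = {P. \<forall>F\<in>A. eval_cox F P = 0}"
proof (intro equalityI subsetI)
  fix P assume "P \<in> affine_zeros (ideal_generated A)"
  then show "P \<in> {P. \<forall>F\<in>A. eval_cox F P = 0}"
    using ideal_generated_superset[of A] by (auto simp: affine_zeros_def)
next
  fix P assume "P \<in> {P. \<forall>F\<in>A. eval_cox F P = 0}"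
  then have "eval_cox F P = 0" if "F \<in> ideal_generated A" for F
    using that by (intro eval_cox_ideal_generated[of F A]) simp_all
  then show "P \<in> affine_zeros (ideal_generated A)"
    by (simp add: affine_zeros_def)
qed

lemma prod_4: "prod f (UNIV :: 4 set) = f 1 * f 2 * f 3 * f 4"
  unfolding UNIV_4 by (simp add: ac_simps)

text \<open>
  The four generators are the products of one of \<open>x\<^sub>1, x\<^sub>3\<close> with one of \<open>x\<^sub>2, x\<^sub>4\<close>.
\<close>

lemma notin_irrelevant_zeros_iff:
  fixes P :: "'a::field ^ 4"
  shows "P \<notin> affine_zeros irrelevant_ideal \<longleftrightarrow>
    (P $ 1 \<noteq> 0 \<or> P $ 3 \<noteq> 0) \<and> (P $ 2 \<noteq> 0 \<or> P $ 4 \<noteq> 0)"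
  unfolding irrelevant_ideal_def affine_zeros_ideal_generated
  by (simp add: eval_cox_xmonom prod_4) blast

lemma mdegree_nth [simp]:
  "mdegree l m $ 1 = int (m $ 1) + int (m $ 3) + int l * int (m $ 4)"
  "mdegree l m $ 2 = int (m $ 2) + int (m $ 4)"
  unfolding mdegree_def \<beta>_def matrix_vector_mult_def sum_4 by simp_all

section \<open>Orbits in the torus\<close>

text \<open>
  The two entries are the Laurent monomials with exponents \<open>u\<^sub>1\<close> and \<open>- u\<^sub>2\<close>. As \<open>u\<^sub>1\<close>, \<open>u\<^sub>2\<close> span
  the kernel of \<open>\<beta>\<close>, they are invariant under \<open>G\<close> and serve as coordinates of the orbits in the
  torus.
\<close>

definition torus_coord :: "nat \<Rightarrow> 'a::field ^ 4 \<Rightarrow> 'a \<times> 'a" where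
  "torus_coord l P = (P $ 1 / P $ 3, P $ 4 / (P $ 2 * P $ 3 ^ l))"

text \<open>
  The invariants separate the orbits in the torus: if \<open>z\<close> and \<open>P\<close> have the same invariants, the
  element of \<open>G\<close> that takes \<open>P\<close> to \<open>z\<close> is found by comparing the second and third coordinates.
\<close>

lemma orbit_torus:
  fixes P :: "'a::field ^ 4"
  assumes "P \<in> torus_coords"
  shows "orbit l P = {z \<in> torus_coords. torus_coord l z = map_prod to_ac to_ac (torus_coord l P)}"
    (is "_ = ?R")
proof (intro equalityI subsetI)
  have P: "P $ 1 \<noteq> 0" "P $ 2 \<noteq> 0" "P $ 3 \<noteq> 0" "P $ 4 \<noteq> 0"
    using assms by (auto simp: torus_coords_def)
  {
    fix z assume "z \<in> orbit l P"
    then obtain t1 t2 where "t1 \<noteq> 0" "t2 \<noteq> 0"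
      "z = vector [t1, t2, t1, t1 ^ l * t2] * (\<chi> i. to_ac (P $ i))"
      unfolding orbit_def G_def by blast
    then show "z \<in> ?R"
      using P by (simp add: torus_coords_def torus_coord_def forall_4 power_mult_distrib)
  next
    fix z assume z: "z \<in> ?R"
    define t1 t2 where "t1 = z $ 3 / to_ac (P $ 3)" and "t2 = z $ 2 / to_ac (P $ 2)"
    have nz: "z $ 1 \<noteq> 0" "z $ 2 \<noteq> 0" "z $ 3 \<noteq> 0" "z $ 4 \<noteq> 0"
      using z by (auto simp: torus_coords_def)
    have 1: "z $ 1 = to_ac (P $ 1) / to_ac (P $ 3) * z $ 3"
      using z nz by (simp add: torus_coord_def field_simps)
    have 4: "z $ 4 = to_ac (P $ 4) / (to_ac (P $ 2) * to_ac (P $ 3) ^ l) * (z $ 2 * z $ 3 ^ l)"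
      using z nz by (simp add: torus_coord_def field_simps)
    have "z = vector [t1, t2, t1, t1 ^ l * t2] * (\<chi> i. to_ac (P $ i))"
      using P 1 4 by (simp add: vec_eq_iff forall_4 t1_def t2_def field_simps)
    moreover have "t1 \<noteq> 0" "t2 \<noteq> 0"
      using nz P by (simp_all add: t1_def t2_def)
    ultimately show "z \<in> orbit l P"
      unfolding orbit_def G_def by blast
  }
qed

lemma torus_coord_to_ac:
  "torus_coord l (\<chi> i. to_ac (P $ i)) = map_prod to_ac to_ac (torus_coord l P)"
  by (simp add: torus_coord_def)

lemma self_in_orbit: "(\<chi> i. to_ac (P $ i)) \<in> orbit l P"
proof -
  have "(\<chi> i. to_ac (P $ i)) = vector [1, 1, 1, 1 ^ l * 1] * (\<chi> i. to_ac (P $ i))"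
    by (simp add: vec_eq_iff forall_4)
  then show ?thesis
    unfolding orbit_def G_def using one_neq_zero by blast
qed

text \<open>
  Orbits are formed over the algebraic closure, so two rational points might be joined by an
  element of \<open>G\<close> that is not rational. Since the invariants of rational points are rational,
  they nevertheless decide the matter over the ground field.
\<close>

lemma orbit_eq_iff:
  fixes P Q :: "'a::field ^ 4"
  assumes "P \<in> torus_coords" "Q \<in> torus_coords"
  shows "orbit l P = orbit l Q \<longleftrightarrow> torus_coord l P = torus_coord l Q"
proof
  assume "orbit l P = orbit l Q"
  then have "(\<chi> i. to_ac (P $ i)) \<in> orbit l Q"
    using self_in_orbit by blast
  then show "torus_coord l P = torus_coord l Q"
    by (simp add: orbit_torus[OF assms(2)] torus_coord_to_ac prod_eq_iff)
qed (simp add: orbit_torus assms)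

lemma torus_coord_mult:
  "torus_coord l (P * Q) =
    (fst (torus_coord l P) * fst (torus_coord l Q), snd (torus_coord l P) * snd (torus_coord l Q))"
  by (simp add: torus_coord_def power_mult_distrib)

lemma orbit_mult:
  fixes P Q :: "'a::field ^ 4"
  assumes P: "P \<in> torus_coords" and Q: "Q \<in> torus_coords"
  shows "{x * y | x y. x \<in> orbit l P \<and> y \<in> orbit l Q} = orbit l (P * Q)" (is "?L = ?R")
proof -
  have PQ: "P * Q \<in> torus_coords"
    using P Q by (simp add: torus_coords_def)
  show ?thesis
  proof (intro equalityI subsetI)
    fix z assume "z \<in> ?L"
    then show "z \<in> ?R"
      using P Q unfolding orbit_torus[OF P] orbit_torus[OF Q] orbit_torus[OF PQ]
      by (auto simp: torus_coords_def torus_coord_mult)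
  next
    fix z assume z: "z \<in> ?R"
    \<comment> \<open>A point of the orbit of \<open>P * Q\<close> is split by taking \<open>Q\<close> itself as the second factor.\<close>
    define y where "y = (\<chi> i. to_ac (Q $ i))"
    define x where "x = (\<chi> i. z $ i / y $ i)"
    have nz: "y $ i \<noteq> 0" for i
      using Q by (simp add: y_def torus_coords_def)
    have eq: "z = x * y"
      using nz by (simp add: x_def vec_eq_iff)
    have "x \<in> torus_coords"
      using z nz by (simp add: orbit_torus[OF PQ] torus_coords_def x_def)
    moreover have "torus_coord l x = map_prod to_ac to_ac (torus_coord l P)"
    proof -
      have "fst (torus_coord l Q) \<noteq> 0" "snd (torus_coord l Q) \<noteq> 0"
        using Q by (auto simp: torus_coord_def torus_coords_def)
      moreover have "torus_coord l y = map_prod to_ac to_ac (torus_coord l Q)"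
        by (simp add: y_def torus_coord_to_ac)
      ultimately show ?thesis
        using z unfolding orbit_torus[OF PQ] eq mem_Collect_eq torus_coord_mult by (simp add: prod_eq_iff)
    qed
    ultimately have "x \<in> orbit l P"
      by (simp add: orbit_torus[OF P])
    moreover have "y \<in> orbit l Q"
      unfolding y_def by (rule self_in_orbit)
    ultimately show "z \<in> ?L" using eq by blast
  qed
qed

lemma torus_coords_mult [intro]: "P \<in> torus_coords \<Longrightarrow> Q \<in> torus_coords \<Longrightarrow> P * Q \<in> torus_coords"
  by (simp add: torus_coords_def)

lemma one_in_torus_coords [simp]: "1 \<in> torus_coords"
  by (simp add: torus_coords_def)

lemma torus_mult:
  assumes "P \<in> torus_coords" "Q \<in> torus_coords"
  shows "orbit l P \<otimes>\<^bsub>torus l\<^esub> orbit l Q = orbit l (P * Q)"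
  using orbit_mult[OF assms, of l] by (simp add: torus_def)

lemma inverse_torus_coords:
  fixes P :: "'a::field ^ 4"
  assumes "P \<in> torus_coords"
  shows "(\<chi> i. inverse (P $ i)) \<in> torus_coords" "(\<chi> i. inverse (P $ i)) * P = 1"
  using assms by (simp_all add: torus_coords_def vec_eq_iff)

lemma torus_group: "group (torus l :: ('a::field alg_closure ^ 4) set monoid)"
proof (rule groupI)
  let ?T = "torus l :: ('a alg_closure ^ 4) set monoid"
  have carrier: "carrier ?T = orbit l ` torus_coords" and one: "\<one>\<^bsub>?T\<^esub> = orbit l (1 :: 'a ^ 4)"
    by (auto simp: torus_def)
  show "x \<otimes>\<^bsub>?T\<^esub> y \<in> carrier ?T" if "x \<in> carrier ?T" "y \<in> carrier ?T" for x y
    using that by (auto simp: carrier torus_mult)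
  show "\<one>\<^bsub>?T\<^esub> \<in> carrier ?T"
    by (simp add: carrier one)
  show "x \<otimes>\<^bsub>?T\<^esub> y \<otimes>\<^bsub>?T\<^esub> z = x \<otimes>\<^bsub>?T\<^esub> (y \<otimes>\<^bsub>?T\<^esub> z)"
    if "x \<in> carrier ?T" "y \<in> carrier ?T" "z \<in> carrier ?T" for x y z
    using that by (auto simp: carrier torus_mult torus_coords_mult mult.assoc)
  show "\<one>\<^bsub>?T\<^esub> \<otimes>\<^bsub>?T\<^esub> x = x" if "x \<in> carrier ?T" for x
    using that by (auto simp: carrier one torus_mult)
  show "\<exists>y\<in>carrier ?T. y \<otimes>\<^bsub>?T\<^esub> x = \<one>\<^bsub>?T\<^esub>" if "x \<in> carrier ?T" for x
  proof -
    from that obtain P :: "'a ^ 4" where P: "P \<in> torus_coords" and x: "x = orbit l P"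
      by (auto simp: carrier)
    show ?thesis
      unfolding x carrier one
      by (rule bexI[of _ "orbit l (\<chi> i. inverse (P $ i))"])
         (simp_all add: torus_mult P inverse_torus_coords[OF P])
  qed
qed

section \<open>The zero locus of the lattice ideal\<close>

text \<open>
  The zero locus only tests homogeneous members of the ideal. A binomial
  \<open>x\<^bsup>m+\<^esup> - x\<^bsup>m-\<^esup>\<close> is homogeneous because \<open>m\<close> lies in the kernel of \<open>\<beta>\<close>.
\<close>

lemma lattice_ideal_zero_imp:
  fixes P :: "'a::field ^ 4"
  assumes "\<forall>F\<in>lattice_ideal L. homogeneous l F \<longrightarrow> eval_cox F P = 0"
    and "m \<in> L" and "mdegree l (pos_part m) = mdegree l (neg_part m)"
  shows "(\<Prod>i\<in>UNIV. P $ i ^ (pos_part m $ i)) = (\<Prod>i\<in>UNIV. P $ i ^ (neg_part m $ i))"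
proof -
  let ?F = "xmonom (pos_part m) - xmonom (neg_part m) :: 'a cox"
  have "Poly_Mapping.keys ?F \<subseteq> {pos_part m, neg_part m}"
    using keys_diff[of "xmonom (pos_part m) :: 'a cox" "xmonom (neg_part m)"]
    by (auto simp: xmonom_def)
  then have "homogeneous l ?F"
    unfolding homogeneous_def graded_piece_def using assms(3)
    by (intro exI[of _ "mdegree l (pos_part m)"]) auto
  moreover have "?F \<in> lattice_ideal L"
    unfolding lattice_ideal_def
    by (rule subsetD[OF ideal_generated_superset]) (use assms(2) in blast)
  ultimately have "eval_cox ?F P = 0"
    using assms(1) by blast
  then show ?thesis
    by (simp only: eval_cox_diff eval_cox_xmonom right_minus_eq)
qed

lemma power_pos_part_eq:
  fixes x :: "'a::field"
  assumes "x \<noteq> 0"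
  shows "x ^ nat k = x ^ nat (- k) * (x powi k)"
  using assms by (auto simp: power_int_def field_simps)

text \<open>
  On the torus \<open>x\<^bsup>m+\<^esup> - x\<^bsup>m-\<^esup> = x\<^bsup>m-\<^esup> (x\<^bsup>m\<^esup> - 1)\<close>, so the binomial vanishes where the Laurent
  monomial \<open>x\<^bsup>m\<^esup>\<close> is \<open>1\<close>.
\<close>

lemma lattice_ideal_vanishes:
  fixes P :: "'a::field ^ 4"
  assumes P: "P \<in> torus_coords"
    and L: "\<And>m. m \<in> L \<Longrightarrow> (\<Prod>i\<in>UNIV. P $ i powi (m $ i)) = 1"
    and F: "F \<in> lattice_ideal L"
  shows "eval_cox F P = 0"
  using F unfolding lattice_ideal_def
proof (rule eval_cox_ideal_generated)
  fix F :: "'a cox" assume "F \<in> {xmonom (pos_part m) - xmonom (neg_part m) | m. m \<in> L}"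
  then obtain m where m: "m \<in> L" and F: "F = xmonom (pos_part m) - xmonom (neg_part m)"
    by blast
  have "(\<Prod>i\<in>UNIV. P $ i ^ (pos_part m $ i)) =
        (\<Prod>i\<in>UNIV. P $ i ^ (neg_part m $ i)) * (\<Prod>i\<in>UNIV. P $ i powi (m $ i))"
    using P unfolding pos_part_def neg_part_def
    by (subst prod.distrib[symmetric], intro prod.cong refl)
       (simp only: torus_coords_def vec_lambda_beta mem_Collect_eq, rule power_pos_part_eq, blast)
  then show "eval_cox F P = 0"
    by (simp only: F eval_cox_diff eval_cox_xmonom L[OF m] right_minus_eq mult_1_right)
qed

definition root_pairs :: "nat \<Rightarrow> nat \<Rightarrow> ('a::field \<times> 'a) set" where
  "root_pairs c1 c2 = {s. s ^ c1 = 1} \<times> {t. t ^ c2 = 1}"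

text \<open>
  The two basis vectors of \<open>L\<close> give the equations \<open>x\<^sub>1\<^bsup>c1\<^esup> = x\<^sub>3\<^bsup>c1\<^esup>\<close> and
  \<open>x\<^sub>2\<^bsup>c2\<^esup> x\<^sub>3\<^bsup>l c2\<^esup> = x\<^sub>4\<^bsup>c2\<^esup>\<close>. They keep the solutions outside \<open>V(B)\<close> inside the torus, and on the torus
  they say that the invariants are roots of unity of orders dividing \<open>c1\<close> and \<open>c2\<close>. Conversely
  every Laurent monomial with exponent in \<open>L\<close> is a product of powers of the \<open>c1\<close>-th power of the
  first and the \<open>c2\<close>-th power of the second invariant.
\<close>

lemma zero_locus_lattice_ideal:
  fixes L :: "(int ^ 4) set"
  assumes c1: "c1 > 0" and c2: "c2 > 0"
    and L: "L = {s *s (int c1 *s u1) + t *s (int c2 *s u2 l) | s t. True}"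
  shows "zero_locus l (lattice_ideal L :: 'a::field cox set) =
    {orbit l P | P. P \<in> torus_coords \<and> torus_coord l P \<in> root_pairs c1 c2}" (is "?Z = ?R")
proof (intro equalityI subsetI)
  fix A assume "A \<in> ?Z"
  then obtain P P' :: "'a ^ 4" where A: "A = orbit l P" "A = orbit l P'"
    and P': "P' \<notin> affine_zeros irrelevant_ideal"
    and van: "\<forall>F\<in>lattice_ideal L. homogeneous l F \<longrightarrow> eval_cox F P = 0"
    unfolding zero_locus_def hirzebruch_points_def by blast
  have "(\<chi> i. to_ac (P $ i)) \<in> orbit l P'"
    using self_in_orbit A by metis
  then obtain t1 t2 where t: "t1 \<noteq> 0" "t2 \<noteq> 0"
      "(\<chi> i. to_ac (P $ i)) = vector [t1, t2, t1, t1 ^ l * t2] * (\<chi> i. to_ac (P' $ i))"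
    unfolding orbit_def G_def by blast
  from t(3) have "to_ac (P $ 1) = t1 * to_ac (P' $ 1)" "to_ac (P $ 2) = t2 * to_ac (P' $ 2)"
    "to_ac (P $ 3) = t1 * to_ac (P' $ 3)" "to_ac (P $ 4) = t1 ^ l * t2 * to_ac (P' $ 4)"
    by (simp_all add: vec_eq_iff forall_4)
  then have zero: "P $ i = 0 \<longleftrightarrow> P' $ i = 0" for i
    using t(1,2) exhaust_4[of i] to_ac_eq_0_iff[of "P $ i"] to_ac_eq_0_iff[of "P' $ i"]
    by (elim disjE) (simp_all del: to_ac_eq_0_iff)
  have nV: "P $ 1 \<noteq> 0 \<or> P $ 3 \<noteq> 0" "P $ 2 \<noteq> 0 \<or> P $ 4 \<noteq> 0"
    using P' by (simp_all add: notin_irrelevant_zeros_iff zero)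
  have m1: "int c1 *s u1 \<in> L"
    unfolding L by (rule CollectI, rule exI[of _ 1], rule exI[of _ 0]) simp
  have m2: "int c2 *s u2 l \<in> L"
    unfolding L by (rule CollectI, rule exI[of _ 0], rule exI[of _ 1]) simp
  have "mdegree l (pos_part (int c1 *s u1)) = mdegree l (neg_part (int c1 *s u1))"
    unfolding vec_eq_iff forall_2 mdegree_nth by (simp add: pos_part_def neg_part_def u1_def)
  from lattice_ideal_zero_imp[OF van m1 this] have e1: "P $ 1 ^ c1 = P $ 3 ^ c1"
    unfolding prod_4 by (simp add: pos_part_def neg_part_def u1_def)
  have "mdegree l (pos_part (int c2 *s u2 l)) = mdegree l (neg_part (int c2 *s u2 l))"
    unfolding vec_eq_iff forall_2 mdegree_nth by (simp add: pos_part_def neg_part_def u2_def)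
  from lattice_ideal_zero_imp[OF van m2 this] have e2: "P $ 2 ^ c2 * P $ 3 ^ (c2 * l) = P $ 4 ^ c2"
    unfolding prod_4 by (simp add: pos_part_def neg_part_def u2_def nat_mult_distrib)
  \<comment> \<open>By the first equation \<open>x\<^sub>1\<close> and \<open>x\<^sub>3\<close> vanish together, which is excluded off \<open>V(B)\<close>; with
    \<open>x\<^sub>3 \<noteq> 0\<close> the second equation does the same for \<open>x\<^sub>2\<close> and \<open>x\<^sub>4\<close>.\<close>
  from e1 c1 have "P $ 1 = 0 \<longleftrightarrow> P $ 3 = 0"
    by (metis power_eq_0_iff)
  with nV(1) have nz13: "P $ 1 \<noteq> 0" "P $ 3 \<noteq> 0" by simp_all
  from e2 c2 nz13(2) have "P $ 2 = 0 \<longleftrightarrow> P $ 4 = 0"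
    by (metis mult_eq_0_iff power_eq_0_iff)
  with nV(2) nz13 have nz: "P $ 1 \<noteq> 0" "P $ 3 \<noteq> 0" "P $ 2 \<noteq> 0" "P $ 4 \<noteq> 0" by simp_all
  then have "P \<in> torus_coords"
    by (simp add: torus_coords_def forall_4)
  moreover have "torus_coord l P \<in> root_pairs c1 c2"
    using nz e1 e2
    by (simp add: torus_coord_def root_pairs_def power_divide power_mult_distrib mult.commute[of c2] flip: power_mult)
  ultimately show "A \<in> ?R" using A by blast
next
  fix A assume "A \<in> ?R"
  then obtain P :: "'a ^ 4" where A: "A = orbit l P" and P: "P \<in> torus_coords"
    and co: "torus_coord l P \<in> root_pairs c1 c2" by blast
  have nz: "P $ 1 \<noteq> 0" "P $ 3 \<noteq> 0" "P $ 2 \<noteq> 0" "P $ 4 \<noteq> 0"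
    using P by (auto simp: torus_coords_def)
  then have nV: "P \<notin> affine_zeros irrelevant_ideal"
    by (simp add: notin_irrelevant_zeros_iff)
  have e: "(P $ 1 / P $ 3) ^ c1 = 1" "(P $ 4 / (P $ 2 * P $ 3 ^ l)) ^ c2 = 1"
    using co by (auto simp: torus_coord_def root_pairs_def)
  have "eval_cox F P = 0" if "F \<in> lattice_ideal L" for F
  proof (rule lattice_ideal_vanishes[OF P _ that])
    fix m assume "m \<in> L"
    then obtain s t where m: "m = s *s (int c1 *s u1) + t *s (int c2 *s u2 l)"
      unfolding L by blast
    have "(P $ 1 / P $ 3) powi (int c1 * s) = 1" "(P $ 4 / (P $ 2 * P $ 3 ^ l)) powi (int c2 * t) = 1"
      using e by (simp_all add: power_int_mult)
    then have "P $ 1 powi (int c1 * s) = P $ 3 powi (int c1 * s)"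
      "P $ 4 powi (int c2 * t) = P $ 2 powi (int c2 * t) * P $ 3 powi (int l * (int c2 * t))"
      using nz by (simp_all add: power_int_divide_distrib power_int_mult_distrib power_int_mult[of _ "int l"])
    moreover have "m $ 1 = int c1 * s" "m $ 2 = int c2 * t"
      "m $ 3 = int l * (int c2 * t) - int c1 * s" "m $ 4 = - (int c2 * t)"
      by (simp_all add: m u1_def u2_def)
    ultimately show "(\<Prod>i\<in>UNIV. P $ i powi (m $ i)) = 1"
      using nz by (simp add: prod_4 power_int_diff power_int_minus) (simp add: field_simps)
  qed
  then show "A \<in> ?Z"
    unfolding zero_locus_def hirzebruch_points_def using A nV by blast
qed

lemma subgroup_torus_coord_root_pairs:
  "subgroup {orbit l P | P :: 'a::field ^ 4. P \<in> torus_coords \<and> torus_coord l P \<in> root_pairs c1 c2}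
    (torus l)"
    (is "subgroup ?Y ?T")
proof -
  interpret group "torus l :: ('a alg_closure ^ 4) set monoid"
    by (rule torus_group)
  have one: "\<one>\<^bsub>?T\<^esub> = orbit l (1 :: 'a ^ 4)"
    by (simp add: torus_def)
  show ?thesis
  proof
    show "?Y \<subseteq> carrier ?T"
      unfolding torus_def partial_object.simps by blast
    show "x \<otimes>\<^bsub>?T\<^esub> y \<in> ?Y" if xy: "x \<in> ?Y" "y \<in> ?Y" for x y
    proof -
      obtain P Q :: "'a ^ 4" where P: "P \<in> torus_coords" "torus_coord l P \<in> root_pairs c1 c2" "x = orbit l P"
        and Q: "Q \<in> torus_coords" "torus_coord l Q \<in> root_pairs c1 c2" "y = orbit l Q"
        using xy by blast
      have "torus_coord l (P * Q) \<in> root_pairs c1 c2"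
        using P(2) Q(2)
        by (cases "torus_coord l P"; cases "torus_coord l Q")
           (simp add: torus_coord_mult root_pairs_def power_mult_distrib)
      moreover have "x \<otimes>\<^bsub>?T\<^esub> y = orbit l (P * Q)"
        by (simp only: P(3) Q(3) torus_mult[OF P(1) Q(1)])
      ultimately show ?thesis
        using torus_coords_mult[OF P(1) Q(1)] by blast
    qed
    show "\<one>\<^bsub>?T\<^esub> \<in> ?Y"
      unfolding one by (rule CollectI, rule exI[of _ 1]) (simp add: torus_coord_def root_pairs_def)
    show "inv\<^bsub>?T\<^esub> x \<in> ?Y" if x: "x \<in> ?Y" for x
    proof -
      obtain P :: "'a ^ 4" where P: "P \<in> torus_coords" "torus_coord l P \<in> root_pairs c1 c2" "x = orbit l P"
        using x by blast
      let ?Q = "\<chi> i. inverse (P $ i)"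
      note Q = inverse_torus_coords[OF P(1)]
      have "inv\<^bsub>?T\<^esub> x = orbit l ?Q"
      proof (rule inv_equality)
        have "orbit l ?Q \<otimes>\<^bsub>?T\<^esub> x = orbit l (?Q * P)"
          unfolding P(3) by (rule torus_mult[OF Q(1) P(1)])
        also have "?Q * P = 1"
          by (rule Q(2))
        finally show "orbit l ?Q \<otimes>\<^bsub>?T\<^esub> x = \<one>\<^bsub>?T\<^esub>"
          by (simp only: one)
        show "x \<in> carrier ?T"
          using P(1,3) unfolding torus_def partial_object.simps by blast
        show "orbit l ?Q \<in> carrier ?T"
          using Q(1) unfolding torus_def partial_object.simps by blast
      qed
      moreover have "torus_coord l ?Q \<in> root_pairs c1 c2"
      proof -
        obtain s t where st: "torus_coord l P = (s, t)" "s ^ c1 = 1" "t ^ c2 = 1"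
          using P(2) unfolding root_pairs_def by (cases "torus_coord l P") simp
        obtain s' t' where st': "torus_coord l ?Q = (s', t')"
          by (rule prod.exhaust)
        have "torus_coord l (?Q * P) = (1, 1)"
          unfolding Q(2) by (simp add: torus_coord_def)
        then have "s' * s = 1" "t' * t = 1"
          unfolding torus_coord_mult st(1) st' by simp_all
        then have "s' ^ c1 * s ^ c1 = 1" "t' ^ c2 * t ^ c2 = 1"
          by (simp_all only: power_mult_distrib[symmetric] power_one)
        then show ?thesis
          by (simp add: st st' root_pairs_def)
      qed
      ultimately show ?thesis using Q(1) by blast
    qed
  qed
qed

section \<open>Roots of unity and zeros on grids\<close>

(* From here on the names of the polynomial operations refer to the type of univariate
   polynomials over a ring class. *)
hide_const (open) Polynomials.degree Polynomials.lead_coeff up_ring.monom up_ring.coeff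

text \<open>
  Multiplication by \<open>x\<close> permutes the units, so the product of all units is unchanged by the
  factor \<open>x\<^bsup>q-1\<^esup>\<close>.
\<close>

lemma finite_field_power_card_minus_1:
  fixes x :: "'a::{field, finite}"
  assumes "x \<noteq> 0"
  shows "x ^ (CARD('a) - 1) = 1"
proof -
  let ?U = "UNIV - {0 :: 'a}"
  have "bij_betw ((*) x) ?U ?U"
    using assms by (intro bij_betwI[where g = "\<lambda>y. y / x"]) auto
  then have "(\<Prod>y\<in>?U. x * y) = (\<Prod>y\<in>?U. y)"
    by (rule prod.reindex_bij_betw)
  moreover have "(\<Prod>y\<in>?U. x * y) = x ^ card ?U * (\<Prod>y\<in>?U. y)"
    by (simp only: prod.distrib prod_constant)
  moreover have "(\<Prod>y\<in>?U. y) \<noteq> 0"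
    by simp
  moreover have "card ?U = CARD('a) - 1"
    by (simp add: card_Diff_singleton)
  ultimately show ?thesis by simp
qed

text \<open>
  The \<open>q - 1\<close> units are roots of \<open>X\<^bsup>q-1\<^esup> - 1 = (X\<^bsup>c\<^esup> - 1) g\<close>, where \<open>g\<close> has degree \<open>q - 1 - c\<close>. As
  \<open>g\<close> has at most that many roots, at least \<open>c\<close> units are left for the first factor.
\<close>

lemma card_roots_of_unity_finite_field:
  assumes c: "c dvd CARD('a::{field, finite}) - 1" "c > 0"
  shows "card {x :: 'a. x ^ c = 1} = c"
proof -
  let ?n = "CARD('a) - 1"
  have n: "?n > 0"
    using card_mono[of UNIV "{0, 1 :: 'a}"] by simp
  from c(1) obtain k where k: "?n = c * k" by blast
  with n have k0: "k > 0" by (cases k) auto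
  define f g :: "'a poly" where "f = monom 1 c - 1" and "g = (\<Sum>i<k. monom 1 (c * i))"
  have f_deg: "degree f \<le> c"
    unfolding f_def by (intro degree_diff_le degree_monom_le) simp
  have f0: "f \<noteq> 0"
  proof
    assume "f = 0"
    then have "coeff f c = 0" by simp
    then show False using c(2) by (simp add: f_def)
  qed
  have poly_f: "poly f x = x ^ c - 1" for x
    by (simp add: f_def poly_monom)
  have poly_g: "poly g x = (\<Sum>i<k. (x ^ c) ^ i)" for x
    by (simp add: g_def poly_sum poly_monom power_mult)
  have g_deg: "degree g \<le> ?n - c"
    unfolding g_def
  proof (intro degree_sum_le)
    fix i assume "i \<in> {..<k}"
    then have "c * i \<le> c * (k - 1)" by auto
    then show "degree (monom (1 :: 'a) (c * i)) \<le> ?n - c"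
      unfolding k by (simp add: degree_monom_eq right_diff_distrib')
  qed simp
  have g0: "g \<noteq> 0"
  proof
    assume "g = 0"
    then have "coeff g 0 = 0" by simp
    moreover have "coeff g 0 = (\<Sum>i<k. if i = 0 then 1 else 0)"
      unfolding g_def coeff_sum using c(2) by (intro sum.cong) auto
    ultimately show False using k0 by simp
  qed
  have "UNIV - {0} \<subseteq> {x. poly f x = 0} \<union> {x. poly g x = 0}"
  proof
    fix x :: 'a assume "x \<in> UNIV - {0}"
    then have "(x ^ c) ^ k = 1"
      using finite_field_power_card_minus_1[of x] unfolding k by (simp add: power_mult)
    then have "(x ^ c - 1) * (\<Sum>i<k. (x ^ c) ^ i) = 0"
      using power_diff_1_eq[of "x ^ c" k] k0 by simp
    then show "x \<in> {x. poly f x = 0} \<union> {x. poly g x = 0}"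
      by (simp add: poly_f poly_g)
  qed
  then have "card (UNIV - {0 :: 'a}) \<le> card ({x. poly f x = 0} \<union> {x. poly g x = 0})"
    by (intro card_mono) simp_all
  also have "\<dots> \<le> card {x. poly f x = 0} + card {x. poly g x = 0}"
    by (rule card_Un_le)
  also have "card {x. poly g x = 0} \<le> ?n - c"
    using card_poly_roots_bound[OF g0] g_deg by simp
  finally have "?n \<le> card {x. poly f x = 0} + (?n - c)"
    by (simp add: card_Diff_singleton)
  moreover have "c \<le> ?n"
    using c(1) n by (rule dvd_imp_le)
  moreover have "card {x. poly f x = 0} \<le> c"
    using card_poly_roots_bound[OF f0] f_deg by simp
  ultimately have "card {x. poly f x = 0} = c" by simp
  then show ?thesis by (simp add: poly_f)
qed

text \<open>
  A bivariate polynomial is a polynomial in \<open>t\<close> whose coefficients are polynomials in \<open>s\<close>.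
\<close>

definition eval2 :: "'a::comm_ring_1 poly poly \<Rightarrow> 'a \<Rightarrow> 'a \<Rightarrow> 'a" where
  "eval2 f s t = poly (poly f [:t:]) s"

lemma eval2_eq_poly: "eval2 f s t = poly (\<Sum>j\<le>degree f. monom (poly (coeff f j) s) j) t"
  by (simp add: eval2_def poly_altdef[of f] poly_sum poly_monom)

lemma card_nonroots_ge:
  fixes p :: "'a::idom poly"
  assumes "finite A" "p \<noteq> 0"
  shows "card A - degree p \<le> card {x\<in>A. poly p x \<noteq> 0}"
proof -
  have "card {x\<in>A. poly p x = 0} \<le> card {x. poly p x = 0}"
    using assms by (intro card_mono poly_roots_finite) auto
  also have "\<dots> \<le> degree p"
    using assms(2) by (rule card_poly_roots_bound)
  finally have "card {x\<in>A. poly p x = 0} \<le> degree p" .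
  moreover have "card A = card {x\<in>A. poly p x = 0} + card {x\<in>A. poly p x \<noteq> 0}"
    using assms(1) by (subst card_Un_disjoint[symmetric]) (auto intro: arg_cong[where f = card])
  ultimately show ?thesis by simp
qed

text \<open>
  For \<open>s\<close> outside the zeros of the leading coefficient, \<open>f(s, t)\<close> is a polynomial in \<open>t\<close> of the
  full degree of \<open>f\<close>, and so has at most \<open>degree f\<close> zeros in \<open>B\<close>. The leading coefficient itself
  excludes at most as many \<open>s\<close> as its degree.
\<close>

lemma card_nonroots_eval2_ge:
  fixes f :: "'a::idom poly poly"
  assumes fin: "finite A" "finite B" and f: "f \<noteq> 0"
  shows "(card A - degree (lead_coeff f)) * (card B - degree f)
    \<le> card {(s, t) \<in> A \<times> B. eval2 f s t \<noteq> 0}"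
proof -
  define A' where "A' = {s\<in>A. poly (lead_coeff f) s \<noteq> 0}"
  have row: "card B - degree f \<le> card {t\<in>B. eval2 f s t \<noteq> 0}" if "s \<in> A'" for s
  proof -
    let ?p = "\<Sum>j\<le>degree f. monom (poly (coeff f j) s) j"
    have "coeff ?p (degree f) \<noteq> 0"
      using that by (simp add: A'_def coeff_sum)
    then have "?p \<noteq> 0" by (metis coeff_0)
    moreover have "degree ?p \<le> degree f"
      by (intro degree_sum_le) (auto intro: order.trans[OF degree_monom_le])
    ultimately show ?thesis
      using card_nonroots_ge[OF fin(2), of ?p] by (simp add: eval2_eq_poly)
  qed
  have "(card A - degree (lead_coeff f)) * (card B - degree f) \<le> card A' * (card B - degree f)"
    unfolding A'_def using f fin(1) by (intro mult_right_mono card_nonroots_ge) auto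
  also have "\<dots> = (\<Sum>s\<in>A'. card B - degree f)"
    by simp
  also have "\<dots> \<le> (\<Sum>s\<in>A'. card {t\<in>B. eval2 f s t \<noteq> 0})"
    by (intro sum_mono row)
  also have "\<dots> = card (SIGMA s:A'. {t\<in>B. eval2 f s t \<noteq> 0})"
    using fin by (subst card_SigmaI) (auto simp: A'_def)
  also have "\<dots> \<le> card {(s, t) \<in> A \<times> B. eval2 f s t \<noteq> 0}"
  proof (rule card_mono)
    show "finite {(s, t) \<in> A \<times> B. eval2 f s t \<noteq> 0}"
      by (rule finite_subset[of _ "A \<times> B"]) (use fin in auto)
  qed (auto simp: A'_def)
  finally show ?thesis .
qed

section \<open>Evaluation codes on grids\<close>

interpretation words: vector_space "\<lambda>a (v :: nat \<Rightarrow> 'a::field) i. a * v i"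
  by unfold_locales (simp_all add: fun_eq_iff algebra_simps)

lemma words_sum_apply: "sum f S i = (\<Sum>x\<in>S. f x i)" for f :: "'b \<Rightarrow> nat \<Rightarrow> 'c::comm_monoid_add"
  by (induction S rule: infinite_finite_induct) auto

text \<open>
  The pair holds the exponent of \<open>t\<close> first and that of \<open>s\<close> second, so that a staircase of exponents
  is a dependent sum indexed by the power of \<open>t\<close>.
\<close>

definition monomial_word ::
  "nat \<Rightarrow> (nat \<Rightarrow> 'a::field) \<Rightarrow> (nat \<Rightarrow> 'a) \<Rightarrow> (nat \<Rightarrow> 'a) \<Rightarrow> nat \<times> nat \<Rightarrow> nat \<Rightarrow> 'a" where
  "monomial_word N w s t e = (\<lambda>i. if i < N then w i * (s i ^ snd e * t i ^ fst e) else 0)"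

text \<open>
  Points numbered \<open>0, \<dots>, N - 1\<close> run through a grid \<open>A \<times> B\<close> by their coordinates \<open>(s i, t i)\<close>. The
  factors \<open>w i\<close> account for the choice of representatives of the points, which rescales the
  components of the code words.
\<close>

locale evaluation_grid =
  fixes A B :: "'a::field set" and N :: nat and w s t :: "nat \<Rightarrow> 'a"
  assumes finite_A: "finite A" and finite_B: "finite B"
    and grid: "bij_betw (\<lambda>i. (s i, t i)) {..<N} (A \<times> B)"
    and w_nz: "i < N \<Longrightarrow> w i \<noteq> 0"
begin

abbreviation mword :: "nat \<times> nat \<Rightarrow> nat \<Rightarrow> 'a" where
  "mword \<equiv> monomial_word N w s t"

text \<open>
  The factors \<open>w i\<close> do not vanish, so the support of a word is the set of grid points at which the
  underlying function is nonzero.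
\<close>

lemma weight_eq:
  assumes "\<And>i. i < N \<Longrightarrow> v i = w i * g (s i) (t i)" "\<And>i. i \<ge> N \<Longrightarrow> v i = 0"
  shows "card {i. v i \<noteq> 0} = card {(x, y) \<in> A \<times> B. g x y \<noteq> 0}"
proof -
  have "v i \<noteq> 0 \<longleftrightarrow> i < N \<and> g (s i) (t i) \<noteq> 0" for i
    using assms[of i] w_nz[of i] by (cases "i < N") simp_all
  then have "{i. v i \<noteq> 0} = {i. i < N \<and> g (s i) (t i) \<noteq> 0}"
    by simp
  moreover have "bij_betw (\<lambda>i. (s i, t i)) {i. i < N \<and> g (s i) (t i) \<noteq> 0}
      {(x, y) \<in> A \<times> B. g x y \<noteq> 0}"
  proof (rule bij_betw_subset[OF grid])
    have "(\<lambda>i. (s i, t i)) ` {..<N} = A \<times> B"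
      using grid by (rule bij_betw_imp_surj_on)
    then have "{(x, y) \<in> A \<times> B. g x y \<noteq> 0} = {(x, y) \<in> (\<lambda>i. (s i, t i)) ` {..<N}. g x y \<noteq> 0}"
      by (simp only:)
    also have "\<dots> = (\<lambda>i. (s i, t i)) ` {i. i < N \<and> g (s i) (t i) \<noteq> 0}"
      by blast
    finally show "(\<lambda>i. (s i, t i)) ` {i. i < N \<and> g (s i) (t i) \<noteq> 0} = {(x, y) \<in> A \<times> B. g x y \<noteq> 0}"
      by (rule sym)
  qed auto
  ultimately show ?thesis
    by (simp add: bij_betw_same_card)
qed

text \<open>
  The witness \<open>J\<close> is the degree in \<open>t\<close> of the polynomial with coefficients \<open>a\<close>, whose leading
  coefficient has degree at most \<open>r J\<close>.
\<close>

lemma weight_ge: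
  fixes m :: nat and r :: "nat \<Rightarrow> nat" and a :: "nat \<times> nat \<Rightarrow> 'a"
  defines "E \<equiv> SIGMA j:{..m}. {..r j}"
  assumes e: "e \<in> E" "a e \<noteq> 0"
  shows "\<exists>J\<le>m. (card A - r J) * (card B - J)
    \<le> card {i. (\<Sum>e\<in>E. (\<lambda>i. a e * mword e i)) i \<noteq> 0}"
proof -
  define p where "p j = (\<Sum>k\<le>r j. monom (a (j, k)) k)" for j
  define f where "f = (\<Sum>j\<le>m. monom (p j) j)"
  have coeff_f: "coeff f j = (if j \<le> m then p j else 0)" for j
    by (simp add: f_def coeff_sum)
  have coeff_p: "coeff (p j) k = (if k \<le> r j then a (j, k) else 0)" for j k
    by (simp add: p_def coeff_sum)
  have "coeff (coeff f (fst e)) (snd e) \<noteq> 0"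
    using e by (auto simp: coeff_f coeff_p E_def)
  then have f0: "f \<noteq> 0" by auto
  have J: "degree f \<le> m"
    by (rule degree_le) (simp add: coeff_f)
  have "degree (lead_coeff f) \<le> r (degree f)"
    by (rule degree_le) (simp add: coeff_f coeff_p)
  then have "(card A - r (degree f)) * (card B - degree f) \<le>
      (card A - degree (lead_coeff f)) * (card B - degree f)"
    by (intro mult_right_mono) auto
  also have "\<dots> \<le> card {(x, y) \<in> A \<times> B. eval2 f x y \<noteq> 0}"
    by (rule card_nonroots_eval2_ge[OF finite_A finite_B f0])
  also have "\<dots> = card {i. (\<Sum>e\<in>E. (\<lambda>i. a e * mword e i)) i \<noteq> 0}"
  proof (rule weight_eq[symmetric])
    fix i assume i: "i < N"
    have "eval2 f (s i) (t i) = (\<Sum>j\<le>m. \<Sum>k\<le>r j. a (j, k) * (s i ^ k * t i ^ j))"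
      by (simp add: eval2_def f_def p_def poly_sum poly_monom sum_distrib_right mult.assoc)
    also have "\<dots> = (\<Sum>(j, k)\<in>E. a (j, k) * (s i ^ k * t i ^ j))"
      unfolding E_def by (rule sum.Sigma) auto
    finally show "(\<Sum>e\<in>E. (\<lambda>i. a e * mword e i)) i = w i * eval2 f (s i) (t i)"
      using i by (simp add: words_sum_apply monomial_word_def sum_distrib_left case_prod_unfold mult.left_commute)
  qed (simp add: words_sum_apply monomial_word_def)
  finally show ?thesis using J by blast
qed

text \<open>
  The bound on the weight is positive as long as every exponent stays below the size of the grid
  in its direction; then no nontrivial combination of the words vanishes.
\<close>

lemma monomial_words_independent:
  fixes m :: nat and r :: "nat \<Rightarrow> nat"
  defines "E \<equiv> SIGMA j:{..m}. {..r j}"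
  assumes m: "m < card B" and r: "\<And>j. j \<le> m \<Longrightarrow> r j < card A"
  shows "inj_on mword E" "words.independent (mword ` E)"
proof -
  have fin: "finite E" unfolding E_def by auto
  have zero: "a e = 0" if "(\<Sum>e\<in>E. (\<lambda>i. a e * mword e i)) = 0" "e \<in> E" for a e
  proof (rule ccontr)
    assume "a e \<noteq> 0"
    with weight_ge[of e m r a] that(2) obtain J where J: "J \<le> m"
      "(card A - r J) * (card B - J) \<le> card {i. (\<Sum>e\<in>E. (\<lambda>i. a e * mword e i)) i \<noteq> 0}"
      unfolding E_def by blast
    have "0 < (card A - r J) * (card B - J)"
      using m r[OF J(1)] J(1) by simp
    with J(2) show False unfolding that(1) by simp
  qed
  show inj: "inj_on mword E"
  proof (rule inj_onI, rule ccontr)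
    fix e e' assume e: "e \<in> E" "e' \<in> E" "mword e = mword e'" "e \<noteq> e'"
    \<comment> \<open>Equal words for different exponents would give a vanishing combination with coefficients
      \<open>1\<close> and \<open>-1\<close>.\<close>
    define a :: "nat \<times> nat \<Rightarrow> 'a" where "a x = (if x = e then 1 else if x = e' then - 1 else 0)" for x
    have "(\<Sum>x\<in>E. (\<lambda>i. a x * mword x i)) = (\<Sum>x\<in>{e, e'}. (\<lambda>i. a x * mword x i))"
      using e fin by (intro sum.mono_neutral_right) (auto simp: a_def fun_eq_iff)
    also have "\<dots> = 0"
      using e(3,4) by (simp add: a_def fun_eq_iff)
    finally have "a e = 0" using zero e(1) by blast
    then show False by (simp add: a_def)
  qed
  show "words.independent (mword ` E)"
  proof (rule words.independent_if_scalars_zero)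
    fix u x assume u: "(\<Sum>x\<in>mword ` E. (\<lambda>i. u x * x i)) = 0" and "x \<in> mword ` E"
    then obtain e where e: "e \<in> E" "x = mword e" by blast
    have "(\<Sum>e\<in>E. (\<lambda>i. u (mword e) * mword e i)) = 0"
      using u by (simp add: sum.reindex[OF inj] o_def)
    from zero[OF this e(1)] e(2) show "u x = 0" by simp
  qed (use fin in simp)
qed

lemma weight_ge_of_span:
  fixes m :: nat and r :: "nat \<Rightarrow> nat"
  assumes m: "m < card B" and r: "\<And>j. j \<le> m \<Longrightarrow> r j < card A"
    and v: "v \<in> words.span (mword ` (SIGMA j:{..m}. {..r j}))" "v \<noteq> 0"
  shows "\<exists>J\<le>m. (card A - r J) * (card B - J) \<le> card {i. v i \<noteq> 0}"
proof -
  let ?E = "SIGMA j:{..m}. {..r j}"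
  have "finite ?E" by auto
  then have "words.span (mword ` ?E) =
      range (\<lambda>u. \<Sum>x\<in>mword ` ?E. (\<lambda>i. u x * x i))"
    by (intro words.span_finite finite_imageI)
  with v(1) obtain u where "v = (\<Sum>x\<in>mword ` ?E. (\<lambda>i. u x * x i))" by blast
  then have v_eq: "v = (\<Sum>e\<in>?E. (\<lambda>i. u (mword e) * mword e i))"
    by (simp add: sum.reindex[OF monomial_words_independent(1)[OF m r]] o_def)
  have "\<exists>e\<in>?E. u (mword e) \<noteq> 0"
  proof (rule ccontr)
    assume "\<not> ?thesis"
    then have "v = (\<Sum>e\<in>?E. 0)"
      unfolding v_eq by (intro sum.cong) (auto simp: fun_eq_iff)
    with v(2) show False by simp
  qed
  then obtain e where "e \<in> ?E" "u (mword e) \<noteq> 0" by blast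
  from weight_ge[of e m r "\<lambda>e. u (mword e)", OF this] show ?thesis
    unfolding v_eq by assumption
qed

text \<open>
  A product of \<open>n\<close> linear factors in \<open>s\<close> and \<open>k\<close> linear factors in \<open>t\<close> vanishes on \<open>n\<close> columns and
  \<open>k\<close> rows of the grid, and nowhere else on it.
\<close>

lemma exists_word_of_weight:
  assumes n: "n \<le> card A" "k \<le> card B" and E: "{..k} \<times> {..n} \<subseteq> E"
  shows "\<exists>v\<in>words.span (mword ` E). card {i. v i \<noteq> 0} = (card A - n) * (card B - k)"
proof -
  obtain A' where A': "A' \<subseteq> A" "card A' = n"
    using n(1) by (meson obtain_subset_with_card_n)
  obtain B' where B': "B' \<subseteq> B" "card B' = k"
    using n(2) by (meson obtain_subset_with_card_n)
  have fin: "finite A'" "finite B'"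
    using A' B' finite_A finite_B finite_subset by blast+
  define g where "g = (\<Prod>x\<in>A'. [:- x, 1:])"
  define h where "h = (\<Prod>y\<in>B'. [:- y, 1:])"
  have deg: "degree g = n" "degree h = k"
    using A'(2) B'(2) by (simp_all add: g_def h_def degree_prod_eq_sum_degree)
  have root: "poly g x = 0 \<longleftrightarrow> x \<in> A'" "poly h y = 0 \<longleftrightarrow> y \<in> B'" for x y
    using fin by (auto simp: g_def h_def poly_prod)
  define v where "v = (\<Sum>j\<le>k. \<Sum>i\<le>n. (\<lambda>x. (coeff g i * coeff h j) * mword (j, i) x))"
  have "v \<in> words.span (mword ` E)"
    unfolding v_def using E by (intro words.span_sum words.span_scale words.span_base) auto
  moreover have "card {i. v i \<noteq> 0} = (card A - n) * (card B - k)"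
  proof -
    have "card {i. v i \<noteq> 0} = card {(x, y) \<in> A \<times> B. poly g x * poly h y \<noteq> 0}"
    proof (rule weight_eq)
      fix x assume x: "x < N"
      have "poly h (t x) * poly g (s x) =
          (\<Sum>j\<le>k. \<Sum>i\<le>n. (coeff h j * t x ^ j) * (coeff g i * s x ^ i))"
        by (simp only: poly_altdef deg sum_product)
      then have "w x * (poly g (s x) * poly h (t x)) =
          (\<Sum>j\<le>k. \<Sum>i\<le>n. w x * ((coeff h j * t x ^ j) * (coeff g i * s x ^ i)))"
        by (simp only: mult.commute[of "poly g _"] sum_distrib_left)
      also have "\<dots> = v x"
        unfolding v_def words_sum_apply monomial_word_def using x
        by (intro sum.cong refl) (simp add: mult_ac)
      finally show "v x = w x * (poly g (s x) * poly h (t x))" by (rule sym)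
    qed (simp add: v_def words_sum_apply monomial_word_def)
    also have "{(x, y) \<in> A \<times> B. poly g x * poly h y \<noteq> 0} = (A - A') \<times> (B - B')"
      by (auto simp: root)
    finally show ?thesis
      using A' B' fin by (simp add: card_cartesian_product card_Diff_subset)
  qed
  ultimately show ?thesis by blast
qed

end

section \<open>The toric code as an evaluation code\<close>

text \<open>
  Up to the factor \<open>x\<^sub>3\<^bsup>c\<^esup> x\<^sub>2\<^bsup>d\<^esup>\<close>, which depends only on the degree \<open>(c, d)\<close>, a monomial is a monomial
  in the invariants.
\<close>

lemma torus_monomial_eq:
  fixes P :: "'a::field ^ 4" and m :: "nat ^ 4"
  assumes P: "P \<in> torus_coords" and "m $ 1 + m $ 3 + l * m $ 4 = c" "m $ 2 + m $ 4 = d"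
  shows "(\<Prod>i\<in>UNIV. P $ i ^ m $ i) =
    P $ 3 ^ c * P $ 2 ^ d * (fst (torus_coord l P) ^ m $ 1 * snd (torus_coord l P) ^ m $ 4)"
proof -
  define s t where "s = fst (torus_coord l P)" and "t = snd (torus_coord l P)"
  have nz: "P $ 2 \<noteq> 0" "P $ 3 \<noteq> 0"
    using P by (auto simp: torus_coords_def)
  have "P $ 1 = s * P $ 3" "P $ 4 = t * (P $ 2 * P $ 3 ^ l)"
    using nz by (simp_all add: s_def t_def torus_coord_def)
  then have "(\<Prod>i\<in>UNIV. P $ i ^ m $ i) =
      (s * P $ 3) ^ m $ 1 * P $ 2 ^ m $ 2 * P $ 3 ^ m $ 3 * (t * (P $ 2 * P $ 3 ^ l)) ^ m $ 4"
    by (simp only: prod_4)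
  also have "\<dots> = P $ 3 ^ c * P $ 2 ^ d * (s ^ m $ 1 * t ^ m $ 4)"
    unfolding assms(2,3)[symmetric] by (simp add: power_mult_distrib power_add power_mult)
  finally show ?thesis unfolding s_def t_def .
qed

text \<open>
  A monomial of degree \<open>(c, d)\<close> is determined by its exponents \<open>j\<close> of \<open>x\<^sub>4\<close> and \<open>k\<close> of \<open>x\<^sub>1\<close>. Those of
  \<open>x\<^sub>3\<close> and \<open>x\<^sub>2\<close> are \<open>c - l j - k\<close> and \<open>d - j\<close>, and the only constraint is that these are not
  negative.
\<close>

lemma toric_code_eq_span:
  fixes P :: "nat \<Rightarrow> 'a::field ^ 4"
  assumes P: "\<And>i. i < N \<Longrightarrow> P i \<in> torus_coords"
    and b: "\<And>j. j \<le> b \<longleftrightarrow> l * j \<le> c \<and> j \<le> d"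
  defines "mw \<equiv> monomial_word N (\<lambda>i. P i $ 3 ^ c * P i $ 2 ^ d)
      (\<lambda>i. fst (torus_coord l (P i))) (\<lambda>i. snd (torus_coord l (P i)))"
  shows "toric_code l (vector [int c, int d]) N P = words.span (mw ` (SIGMA j:{..b}. {..c - l * j}))"
    (is "?C = words.span (mw ` ?E)")
proof (intro equalityI subsetI)
  let ?\<alpha> = "vector [int c, int d] :: int ^ 2"
  have deg: "mdegree l m = ?\<alpha> \<longleftrightarrow> m $ 1 + m $ 3 + l * m $ 4 = c \<and> m $ 2 + m $ 4 = d" for m :: "nat ^ 4"
    unfolding vec_eq_iff forall_2 mdegree_nth vector_2 by (simp flip: of_nat_add of_nat_mult)
  have mono: "(\<Prod>i\<in>UNIV. P x $ i ^ m $ i) = mw (m $ 4, m $ 1) x" if "mdegree l m = ?\<alpha>" "x < N"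
    for m :: "nat ^ 4" and x
    using torus_monomial_eq[OF P[OF that(2)], of m l c d] that by (simp add: deg mw_def monomial_word_def)
  {
    fix v assume "v \<in> ?C"
    then obtain F :: "'a cox" where F: "F \<in> graded_piece l ?\<alpha>"
      and v: "v = (\<lambda>i. if i < N then eval_cox F (P i) else 0)"
      unfolding toric_code_def by blast
    have F_deg: "mdegree l m = ?\<alpha>" if "m \<in> Poly_Mapping.keys F" for m
      using F that by (simp add: graded_piece_def)
    have "v = (\<Sum>m\<in>Poly_Mapping.keys F. (\<lambda>i. Poly_Mapping.lookup F m * mw (m $ 4, m $ 1) i))"
    proof
      fix x
      show "v x = (\<Sum>m\<in>Poly_Mapping.keys F. (\<lambda>i. Poly_Mapping.lookup F m * mw (m $ 4, m $ 1) i)) x"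
      proof (cases "x < N")
        case True
        then have "v x = (\<Sum>m\<in>Poly_Mapping.keys F.
            Poly_Mapping.lookup F m * (\<Prod>i\<in>UNIV. P x $ i ^ m $ i))"
          by (simp only: v eval_cox_def if_True)
        also have "\<dots> = (\<Sum>m\<in>Poly_Mapping.keys F. Poly_Mapping.lookup F m * mw (m $ 4, m $ 1) x)"
          by (intro sum.cong refl arg_cong2[where f = "(*)"] mono F_deg True)
        finally show ?thesis by (simp only: words_sum_apply)
      qed (simp add: v words_sum_apply mw_def monomial_word_def)
    qed
    moreover have "(m $ 4, m $ 1) \<in> ?E" if "m \<in> Poly_Mapping.keys F" for m :: "nat ^ 4"
    proof -
      from F_deg[OF that] have m: "m $ 1 + m $ 3 + l * m $ 4 = c" "m $ 2 + m $ 4 = d"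
        by (simp_all only: deg)
      then have "l * m $ 4 \<le> c" "m $ 4 \<le> d" "m $ 1 \<le> c - l * m $ 4" by linarith+
      then show ?thesis by (simp add: b)
    qed
    ultimately show "v \<in> words.span (mw ` ?E)"
      by (simp only:) (intro words.span_sum words.span_scale words.span_base imageI)
  next
    fix v assume "v \<in> words.span (mw ` ?E)"
    then show "v \<in> ?C"
    proof (induction rule: words.span_induct_alt)
      case base
      show ?case
        unfolding toric_code_def by (rule image_eqI[of _ _ 0]) (auto simp: graded_piece_def)
    next
      case (step a x y)
      from step(1) obtain j k where jk: "(j, k) \<in> ?E" and x: "x = mw (j, k)" by blast
      from step(2) obtain F :: "'a cox" where F: "F \<in> graded_piece l ?\<alpha>"
        and y: "y = (\<lambda>i. if i < N then eval_cox F (P i) else 0)"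
        unfolding toric_code_def by blast
      from jk have bounds: "l * j \<le> c" "j \<le> d" "k \<le> c - l * j" by (auto simp: b)
      define m :: "nat ^ 4" where "m = vector [k, d - j, c - l * j - k, j]"
      have m: "mdegree l m = ?\<alpha>"
        unfolding deg m_def using bounds by simp
      have "Poly_Mapping.single m a + F \<in> graded_piece l ?\<alpha>"
        using F m Poly_Mapping.keys_add[of "Poly_Mapping.single m a" F]
        by (auto simp: graded_piece_def split: if_splits)
      moreover have "(\<lambda>i. a * x i) + y = (\<lambda>i. if i < N then eval_cox (Poly_Mapping.single m a + F) (P i) else 0)"
      proof
        fix i
        show "((\<lambda>i. a * x i) + y) i = (if i < N then eval_cox (Poly_Mapping.single m a + F) (P i) else 0)"
        proof (cases "i < N")
          case True
          with mono[OF m True] show ?thesis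
            by (simp add: eval_cox_add eval_cox_single y x) (simp add: m_def)
        qed (simp add: y x mw_def monomial_word_def)
      qed
      ultimately show ?case
        unfolding toric_code_def by (rule image_eqI[rotated])
    qed
  }
qed

text \<open>
  On roots of unity the exponents matter only modulo \<open>c1\<close> and \<open>c2\<close>. The reduced exponents stay in
  the staircase since lowering \<open>j\<close> only enlarges the range of \<open>k\<close>.
\<close>

lemma monomial_words_mod:
  fixes w s t :: "nat \<Rightarrow> 'a::field"
  assumes c1: "c1 > 0" and c2: "c2 > 0"
    and st: "\<And>i. i < N \<Longrightarrow> s i ^ c1 = 1 \<and> t i ^ c2 = 1"
  shows "monomial_word N w s t ` (SIGMA j:{..b}. {..c - l * j}) =
    monomial_word N w s t ` (SIGMA j:{..min b (c2 - 1)}. {..min (c - l * j) (c1 - 1)})"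
    (is "?mw ` ?E = ?mw ` ?E'")
proof (intro equalityI subsetI)
  have pow_mod: "x ^ (n mod q) = x ^ n" if "x ^ q = 1" for x :: 'a and n q :: nat
  proof -
    have "x ^ n = x ^ (q * (n div q) + n mod q)" by simp
    also have "\<dots> = x ^ (n mod q)"
      by (simp only: power_add power_mult that power_one mult_1_left)
    finally show ?thesis by (rule sym)
  qed
  fix v assume "v \<in> ?mw ` ?E"
  then obtain j k where jk: "j \<le> b" "k \<le> c - l * j" and v: "v = ?mw (j, k)" by auto
  have "v = ?mw (j mod c2, k mod c1)"
    unfolding v monomial_word_def using st by (intro ext) (simp add: pow_mod)
  moreover have "(j mod c2, k mod c1) \<in> ?E'"
  proof -
    have "j mod c2 \<le> j" "k mod c1 \<le> k" by simp_all
    moreover have "j mod c2 < c2" "k mod c1 < c1" using c1 c2 by simp_all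
    moreover have "c - l * j \<le> c - l * (j mod c2)"
      by (intro diff_le_mono2 mult_le_mono2) simp
    ultimately have "j mod c2 \<le> min b (c2 - 1)"
      "k mod c1 \<le> min (c - l * (j mod c2)) (c1 - 1)"
      using jk by linarith+
    then show ?thesis by blast
  qed
  ultimately show "v \<in> ?mw ` ?E'" by blast
qed auto

section \<open>Dimension and minimum distance\<close>

text \<open>
  In the case at hand the first factor on the right is \<open>c1 - c + l J\<close>, and the right side
  exceeds the left by \<open>J ((l c2 - c1) + (c - l J))\<close>.
\<close>

lemma weight_bound_lt:
  fixes c c1 c2 l J :: nat
  assumes "c < c1" "c1 \<le> l * c2" "J < c2" "l * J \<le> c"
  shows "c2 * (c1 - c) \<le> (c1 - min (c - l * J) (c1 - 1)) * (c2 - J)"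
proof -
  have "int (c1 - min (c - l * J) (c1 - 1)) = int c1 - int c + int l * int J"
    using assms by (simp add: of_nat_diff)
  moreover have "(int c1 - int c + int l * int J) * (int c2 - int J) - int c2 * (int c1 - int c) =
      int J * ((int l * int c2 - int c1) + (int c - int l * int J))"
    by (simp add: algebra_simps)
  moreover have "0 \<le> int J * ((int l * int c2 - int c1) + (int c - int l * int J))"
    using assms(2,4) by (intro mult_nonneg_nonneg add_nonneg_nonneg) (simp_all flip: of_nat_mult)
  ultimately have "0 \<le> int (c1 - min (c - l * J) (c1 - 1)) * (int c2 - int J) - int c2 * (int c1 - int c)"
    by (simp only:)
  moreover have "int (c1 - c) = int c1 - int c" "int (c2 - J) = int c2 - int J"
    using assms by (simp_all add: of_nat_diff)
  ultimately have "int (c2 * (c1 - c)) \<le> int ((c1 - min (c - l * J) (c1 - 1)) * (c2 - J))"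
    by (simp only: of_nat_mult diff_ge_0_iff_ge)
  then show ?thesis by (simp only: of_nat_le_iff)
qed

text \<open>
  For \<open>J \<le> b'\<close> the powers of \<open>s\<close> are unrestricted modulo \<open>c1\<close>, the first factor is \<open>1\<close>, and the
  bound is \<open>c2 - J\<close>. For \<open>J = b' + 1 + e\<close> the maximality of \<open>b'\<close> makes the first factor at least
  \<open>2 + e\<close>, and \<open>(2 + e) (c2 - J) \<ge> (c2 - J) + (1 + e) = c2 - b'\<close>.
\<close>

lemma weight_bound_ge:
  fixes c c1 c2 l J b' :: nat
  assumes "l > 0" "c1 > 0" "J < c2" "J \<le> b"
    and b': "\<And>j. j \<le> b' \<longleftrightarrow> c1 - 1 + l * j \<le> c \<and> j \<le> d"
    and "b \<le> d" "l * J \<le> c"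
  shows "c2 - min b' (c2 - 1) \<le> (c1 - min (c - l * J) (c1 - 1)) * (c2 - J)"
proof (cases "J \<le> b'")
  case True
  then have "c1 - 1 \<le> c - l * J"
    using b'[of J] by linarith
  then have "min (c - l * J) (c1 - 1) = c1 - 1"
    by (rule min_absorb2)
  then show ?thesis using True assms(2,3) by simp
next
  case False
  then have "\<not> c1 - 1 + l * (b' + 1) \<le> c"
    using b'[of "b' + 1"] assms(4,6) by simp
  then have 1: "c + 2 \<le> c1 + l * b' + l"
    using assms(2) by (simp add: algebra_simps)
  obtain e where e: "J = b' + 1 + e"
    using False by (metis add.commute less_iff_Suc_add not_le plus_1_eq_Suc add.assoc Suc_eq_plus1 add_Suc_right)
  have le: "e \<le> l * e" using assms(1) by simp
  have "l * J = l * b' + l + l * e"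
    by (simp add: e algebra_simps)
  then have "c - l * J + (2 + e) \<le> c1"
    using 1 le assms(7) by linarith
  then have "c1 - min (c - l * J) (c1 - 1) \<ge> 2 + e"
    by linarith
  then have "(2 + e) * (c2 - J) \<le> (c1 - min (c - l * J) (c1 - 1)) * (c2 - J)"
    by (rule mult_le_mono1)
  moreover have "(1 + e) * 1 \<le> (1 + e) * (c2 - J)"
    using assms(3) by (intro mult_le_mono2) simp
  then have "c2 - b' \<le> (2 + e) * (c2 - J)"
    using assms(3) unfolding e by (simp add: algebra_simps)
  moreover have "min b' (c2 - 1) = b'"
    using False assms(3) by simp
  ultimately show ?thesis by simp
qed

lemma sum_arith_atMost:
  fixes x y :: real
  shows "(\<Sum>j\<le>n. x - y * real j) = (real n + 1) * (x - real n * y / 2)"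
  by (induction n) (simp_all add: field_simps)

lemma sum_arith_greaterThanAtMost:
  fixes x y :: real
  assumes "p \<le> n"
  shows "(\<Sum>j\<in>{p<..n}. x - y * real j) = (real n - real p) * (x - y * (real n + real p + 1) / 2)"
  using assms
proof (induction n rule: dec_induct)
  case (step n)
  then have "{p<..Suc n} = insert (Suc n) {p<..n}" by auto
  then show ?case using step by (simp add: field_simps)
qed simp

lemma le_Greatest_nat_iff:
  fixes Q :: "nat \<Rightarrow> bool"
  assumes "Q 0" "\<And>k. Q k \<Longrightarrow> k \<le> d" "\<And>j k. j \<le> k \<Longrightarrow> Q k \<Longrightarrow> Q j"
  shows "j \<le> (GREATEST k. Q k) \<longleftrightarrow> Q j"
proof
  have "Q (GREATEST k. Q k)"
    using assms(1,2) by (rule GreatestI_nat)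
  then show "Q j" if "j \<le> (GREATEST k. Q k)"
    using assms(3) that by blast
  show "j \<le> (GREATEST k. Q k)" if "Q j"
    using that assms(2) by (rule Greatest_le_nat)
qed

text \<open>
  The points of the code, numbered by their representatives, run through \<open>\<mu>\<^bsub>c1\<^esub> \<times> \<mu>\<^bsub>c2\<^esub>\<close>. The pair
  \<open>(x, y)\<close> is attained at the orbit of \<open>(x, 1, 1, y)\<close>.
\<close>

lemma representatives_grid:
  fixes P :: "nat \<Rightarrow> 'a::field ^ 4"
  assumes c1: "c1 > 0" and c2: "c2 > 0"
    and rep: "representatives l
      {orbit l P | P :: 'a ^ 4. P \<in> torus_coords \<and> torus_coord l P \<in> root_pairs c1 c2} N P"
  shows "bij_betw (\<lambda>i. torus_coord l (P i)) {..<N} (root_pairs c1 c2)"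
proof -
  let ?Y = "{orbit l P | P :: 'a ^ 4. P \<in> torus_coords \<and> torus_coord l P \<in> root_pairs c1 c2}"
  have P: "P i \<in> torus_coords" if "i < N" for i
    using rep that by (simp add: representatives_def)
  have bij: "bij_betw (\<lambda>i. orbit l (P i)) {..<N} ?Y"
    using rep by (simp add: representatives_def)
  then have inj: "inj_on (\<lambda>i. orbit l (P i)) {..<N}" and img: "(\<lambda>i. orbit l (P i)) ` {..<N} = ?Y"
    by (simp_all only: bij_betw_def)
  show ?thesis
    unfolding bij_betw_def
  proof (intro conjI equalityI subsetI)
    show "inj_on (\<lambda>i. torus_coord l (P i)) {..<N}"
    proof (rule inj_onI)
      fix i j assume ij: "i \<in> {..<N}" "j \<in> {..<N}" "torus_coord l (P i) = torus_coord l (P j)"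
      then have "orbit l (P i) = orbit l (P j)"
        by (subst orbit_eq_iff) (simp_all add: P)
      with inj ij show "i = j" by (simp add: inj_on_def)
    qed
  next
    fix z assume "z \<in> (\<lambda>i. torus_coord l (P i)) ` {..<N}"
    then obtain i where i: "i < N" "z = torus_coord l (P i)" by auto
    then have "orbit l (P i) \<in> ?Y" using img by blast
    then obtain Q :: "'a ^ 4" where Q: "orbit l (P i) = orbit l Q" "Q \<in> torus_coords"
      "torus_coord l Q \<in> root_pairs c1 c2" by blast
    then show "z \<in> root_pairs c1 c2"
      using orbit_eq_iff[OF P[OF i(1)] Q(2)] i(2) by simp
  next
    fix z :: "'a \<times> 'a" assume z: "z \<in> root_pairs c1 c2"
    then obtain x y where xy: "z = (x, y)" "x ^ c1 = 1" "y ^ c2 = 1"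
      by (auto simp: root_pairs_def)
    have nz: "x \<noteq> 0" "y \<noteq> 0"
      using xy(2,3) c1 c2 by (auto simp: power_0_left)
    define Q :: "'a ^ 4" where "Q = vector [x, 1, 1, y]"
    have Q: "Q \<in> torus_coords" "torus_coord l Q = z"
      using nz by (simp_all add: Q_def torus_coords_def forall_4 torus_coord_def xy(1))
    then have "orbit l Q \<in> ?Y" using z by blast
    then obtain i where i: "i < N" "orbit l Q = orbit l (P i)"
      using img by (metis (no_types, lifting) imageE lessThan_iff)
    then have "torus_coord l (P i) = z"
      using orbit_eq_iff[OF Q(1) P[OF i(1)]] Q(2) by simp
    then show "z \<in> (\<lambda>i. torus_coord l (P i)) ` {..<N}"
      using i(1) by blast
  qed
qed

lemma min_distanceI:
  assumes "\<And>v. v \<in> C \<Longrightarrow> v \<noteq> 0 \<Longrightarrow> \<delta> \<le> card {i. v i \<noteq> 0}"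
    and "v \<in> C" "card {i. v i \<noteq> 0} = \<delta>" "\<delta> > 0"
  shows "min_distance C = \<delta>"
  unfolding min_distance_def
proof (rule Least_equality)
  have "v \<noteq> 0" using assms(3,4) by auto
  then show "\<exists>v\<in>C. v \<noteq> 0 \<and> \<delta> = card {i. v i \<noteq> 0}"
    using assms(2,3) by auto
qed (use assms(1) in blast)

text \<open>
  The dimension counts the reduced staircase row by row. For the minimum distance, the lower bound
  \<open>(c1 - r J) (c2 - J)\<close> holds for some row \<open>J\<close>. The extreme word is a product of linear factors: for
  \<open>c < c1\<close> all \<open>c\<close> factors are in \<open>s\<close>; otherwise \<open>c1 - 1\<close> factors in \<open>s\<close> leave a single column, on which
  factors in \<open>t\<close> remove as many points as the staircase permits.
\<close>

lemma toric_code_parameters: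
  fixes P :: "nat \<Rightarrow> 'a::{field, finite} ^ 4"
  assumes l: "l > 0" and c1: "c1 > 0" and c2: "c2 > 0"
    and dvd: "c1 dvd CARD('a) - 1" "c2 dvd CARD('a) - 1" and c1_le: "c1 \<le> l * c2"
    and b: "\<And>j. j \<le> b \<longleftrightarrow> l * j \<le> c \<and> j \<le> d"
    and b': "\<And>j. c1 \<le> c \<Longrightarrow> j \<le> b' \<longleftrightarrow> c1 - 1 + l * j \<le> c \<and> j \<le> d"
    and rep: "representatives l
      {orbit l P | P :: 'a ^ 4. P \<in> torus_coords \<and> torus_coord l P \<in> root_pairs c1 c2} N P"
  defines "C \<equiv> toric_code l (vector [int c, int d]) N P"
  shows "code_dim C = (\<Sum>j\<le>min b (c2 - 1). Suc (min (c - l * j) (c1 - 1)))"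
    and "min_distance C = (if c < c1 then c2 * (c1 - c) else c2 - min b' (c2 - 1))"
proof -
  define A B where "A = {s :: 'a. s ^ c1 = 1}" and "B = {t :: 'a. t ^ c2 = 1}"
  have card: "card A = c1" "card B = c2"
    unfolding A_def B_def using dvd c1 c2 by (simp_all add: card_roots_of_unity_finite_field)
  define w s t where "w i = P i $ 3 ^ c * P i $ 2 ^ d"
    and "s i = fst (torus_coord l (P i))" and "t i = snd (torus_coord l (P i))" for i
  have P: "P i \<in> torus_coords" if "i < N" for i
    using rep that by (simp add: representatives_def)
  have grid: "bij_betw (\<lambda>i. (s i, t i)) {..<N} (A \<times> B)"
    using representatives_grid[OF c1 c2 rep] by (simp add: s_def t_def A_def B_def root_pairs_def)
  interpret evaluation_grid A B N w s t
  proof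
    show "w i \<noteq> 0" if "i < N" for i
      using P[OF that] by (simp add: w_def torus_coords_def)
  qed (simp_all add: grid)
  have st: "s i ^ c1 = 1 \<and> t i ^ c2 = 1" if "i < N" for i
    using bij_betwE[OF grid] that by (simp add: A_def B_def)
  define m where "m = min b (c2 - 1)"
  define r where "r j = min (c - l * j) (c1 - 1)" for j
  have m: "m < card B"
    using c2 by (simp add: m_def card)
  have r: "r j < card A" for j
    using c1 by (simp add: r_def card min_less_iff_disj)
  have C_full: "C = words.span (mword ` (SIGMA j:{..b}. {..c - l * j}))"
    unfolding C_def w_def s_def t_def by (rule toric_code_eq_span[OF P b])
  have C: "C = words.span (mword ` (SIGMA j:{..m}. {..r j}))"
    unfolding C_full m_def r_def by (subst monomial_words_mod[OF c1 c2 st]) simp_all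
  have "code_dim C = card (mword ` (SIGMA j:{..m}. {..r j}))"
    unfolding code_dim_def C
    by (rule words.dim_span_eq_card_independent[OF monomial_words_independent(2)[OF m r]])
  also have "\<dots> = card (SIGMA j:{..m}. {..r j})"
    by (rule card_image[OF monomial_words_independent(1)[OF m r]])
  also have "\<dots> = (\<Sum>j\<le>m. Suc (r j))"
    by simp
  finally show "code_dim C = (\<Sum>j\<le>min b (c2 - 1). Suc (min (c - l * j) (c1 - 1)))"
    by (simp only: m_def r_def)
  show "min_distance C = (if c < c1 then c2 * (c1 - c) else c2 - min b' (c2 - 1))" (is "_ = ?\<delta>")
  proof -
    have lower: "?\<delta> \<le> card {i. v i \<noteq> 0}" if v: "v \<in> C" "v \<noteq> 0" for v
    proof -
      obtain J where J: "J \<le> m" "(c1 - r J) * (c2 - J) \<le> card {i. v i \<noteq> 0}"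
        using weight_ge_of_span[OF m r v(1)[unfolded C] v(2)] unfolding card by metis
      have J': "J < c2" "J \<le> b" "l * J \<le> c"
        using J(1) c2 b[of J] unfolding m_def by linarith+
      have "?\<delta> \<le> (c1 - r J) * (c2 - J)"
      proof (cases "c < c1")
        case True
        then show ?thesis
          using weight_bound_lt[OF True c1_le J'(1,3)] by (simp add: r_def)
      next
        case False
        have "b \<le> d" using b[of b] by simp
        with False show ?thesis
          using weight_bound_ge[OF l c1 J'(1,2) b' _ J'(3)] by (simp add: r_def)
      qed
      with J(2) show ?thesis by simp
    qed
    define n k where "n = (if c < c1 then c else c1 - 1)" and "k = (if c < c1 then 0 else min b' (c2 - 1))"
    have "n \<le> card A" "k \<le> card B"
      unfolding n_def k_def card by auto
    moreover have "{..k} \<times> {..n} \<subseteq> (SIGMA j:{..b}. {..c - l * j})"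
    proof (cases "c < c1")
      case True
      then show ?thesis by (auto simp: n_def k_def)
    next
      case False
      have "j \<le> b \<and> c1 - 1 \<le> c - l * j" if "j \<le> b'" for j
      proof -
        have "c1 - 1 + l * j \<le> c" "j \<le> d"
          using b'[of j] that False by simp_all
        then show ?thesis by (simp add: b)
      qed
      with False show ?thesis by (fastforce simp: n_def k_def)
    qed
    ultimately obtain v where v: "v \<in> C" "card {i. v i \<noteq> 0} = (c1 - n) * (c2 - k)"
      using exists_word_of_weight[of n k] unfolding C_full card by blast
    have "(c1 - n) * (c2 - k) = ?\<delta>"
      using c1 by (simp add: n_def k_def)
    moreover have "?\<delta> > 0"
      using c2 by (auto simp: min_def)
    ultimately show ?thesis
      using v lower by (intro min_distanceI[of C _ v]) simp_all
  qed
qed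

text \<open>
  No row is cut off at \<open>c1\<close>, so the row lengths form an arithmetic progression.
\<close>

lemma dimension_lt:
  fixes c c1 l m :: nat
  assumes "c < c1" "\<And>j. j \<le> m \<Longrightarrow> l * j \<le> c"
  shows "real (\<Sum>j\<le>m. Suc (min (c - l * j) (c1 - 1))) = (real m + 1) * (real c + 1 - real m * real l / 2)"
proof -
  have "real (Suc (min (c - l * j) (c1 - 1))) = (real c + 1) - real l * real j" if "j \<le> m" for j
  proof -
    have "min (c - l * j) (c1 - 1) = c - l * j"
      using assms(1) by (intro min_absorb1) simp
    then show ?thesis
      using assms(2)[OF that] by (simp add: of_nat_diff)
  qed
  then have "real (\<Sum>j\<le>m. Suc (min (c - l * j) (c1 - 1))) = (\<Sum>j\<le>m. (real c + 1) - real l * real j)"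
    unfolding of_nat_sum by (intro sum.cong refl) simp
  then show ?thesis
    by (simp only: sum_arith_atMost)
qed

text \<open>
  The rows up to \<open>p\<close> are cut off at the length \<open>c1\<close>; the lengths of the others form an arithmetic
  progression with step \<open>- l\<close>.
\<close>

lemma dimension_ge:
  fixes c c1 l m :: nat
  assumes "c1 > 0" "p \<le> m" "\<And>j. j \<le> p \<Longrightarrow> c1 - 1 + l * j \<le> c"
    and "\<And>j. p < j \<Longrightarrow> j \<le> m \<Longrightarrow> l * j \<le> c \<and> c < c1 - 1 + l * j"
  shows "real (\<Sum>j\<le>m. Suc (min (c - l * j) (c1 - 1))) =
    real c1 * (real p + 1) + (real m - real p) * (real c + 1 - real l * (real m + real p + 1) / 2)"
proof -
  let ?f = "\<lambda>j. real (Suc (min (c - l * j) (c1 - 1)))"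
  have "?f j = real c1" if "j \<le> p" for j
  proof -
    have "c1 - 1 \<le> c - l * j"
      using assms(3)[OF that] by linarith
    then have "min (c - l * j) (c1 - 1) = c1 - 1"
      by (rule min_absorb2)
    then show ?thesis using assms(1) by simp
  qed
  then have 1: "(\<Sum>j\<le>p. ?f j) = real c1 * (real p + 1)"
    by (simp add: algebra_simps)
  have "?f j = (real c + 1) - real l * real j" if "p < j" "j \<le> m" for j
  proof -
    have "c - l * j \<le> c1 - 1"
      using assms(4)[OF that] by linarith
    then have "min (c - l * j) (c1 - 1) = c - l * j"
      by (rule min_absorb1)
    then show ?thesis
      using assms(4)[OF that] by (simp add: of_nat_diff)
  qed
  then have 2: "(\<Sum>j\<in>{p<..m}. ?f j) = (\<Sum>j\<in>{p<..m}. (real c + 1) - real l * real j)"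
    by (intro sum.cong refl) simp
  have "{..m} = {..p} \<union> {p<..m}"
    using assms(2) by auto
  then have "(\<Sum>j\<le>m. ?f j) = (\<Sum>j\<le>p. ?f j) + (\<Sum>j\<in>{p<..m}. ?f j)"
    by (simp only:) (rule sum.union_disjoint; auto)
  then show ?thesis
    unfolding of_nat_sum 1 2 sum_arith_greaterThanAtMost[OF assms(2)] .
qed

theorem theorem8p4:
  fixes l c1 c2 c d b b' :: nat
    and L :: "(int ^ 4) set"
    and Y :: "('a::{field, finite} alg_closure ^ 4) set set"
    and \<alpha> :: "int ^ 2"
  assumes "l > 0"
    and "c1 > 0" and "c2 > 0"
    and "c1 dvd CARD('a) - 1" and "c2 dvd CARD('a) - 1"
    and "c1 \<le> l * c2"
    and L_def: "L = {s *s (int c1 *s u1) + t *s (int c2 *s u2 l) | s t. True}"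
    and Y_def: "Y = zero_locus l (lattice_ideal L :: 'a cox set)"
    and \<alpha>_def: "\<alpha> = vector [int c, int d]"
    and b_def: "b = (GREATEST k::nat. int c - int k * int l \<ge> 0 \<and> int d - int k \<ge> 0)"
    and b'_def: "c \<ge> c1 \<Longrightarrow>
      b' = (GREATEST k::nat. int c - int k * int l \<ge> int c1 - 1 \<and> int d - int k \<ge> 0)"
  shows "subgroup Y (torus l) \<and>
    (\<forall>N (P :: nat \<Rightarrow> 'a ^ 4). representatives l Y N P \<longrightarrow>
      (let K = real (code_dim (toric_code l \<alpha> N P));
           \<delta> = int (min_distance (toric_code l \<alpha> N P))
       in
        (c < c1 \<and> b \<le> c2 - 1 \<longrightarrow>
           K = (real b + 1) * (real c + 1 - real b * real l / 2) \<and>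
           \<delta> = int c2 * (int c1 - int c)) \<and>
        (c < c1 \<and> c2 - 1 < b \<longrightarrow>
           K = real c2 * (real c + 1 - (real c2 - 1) * real l / 2) \<and>
           \<delta> = int c2 * (int c1 - int c)) \<and>
        (c \<ge> c1 \<and> b' \<le> b \<and> b < c2 - 1 \<longrightarrow>
           K = real c1 * (real b' + 1) +
               (real b - real b') * (real c + 1 - real l * (real b + real b' + 1) / 2) \<and>
           \<delta> = int c2 - int b') \<and>
        (c \<ge> c1 \<and> b' < c2 - 1 \<and> c2 - 1 \<le> b \<longrightarrow>
           K = real c1 * (real b' + 1) +
               (real c2 - 1 - real b') * (real c + 1 - real l * (real c2 + real b') / 2) \<and>
           \<delta> = int c2 - int b') \<and>
        (c \<ge> c1 \<and> b' \<ge> c2 - 1 \<longrightarrow>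
           K = real c1 * real c2 \<and> \<delta> = 1)))"
proof -
  note pos = \<open>l > 0\<close> \<open>c1 > 0\<close> \<open>c2 > 0\<close>
  have Y: "Y = {orbit l P | P :: 'a ^ 4. P \<in> torus_coords \<and> torus_coord l P \<in> root_pairs c1 c2}"
    unfolding Y_def by (rule zero_locus_lattice_ideal[OF pos(2,3) L_def])
  have b_iff: "j \<le> b \<longleftrightarrow> l * j \<le> c \<and> j \<le> d" for j
  proof -
    have eq: "(int c - int k * int l \<ge> 0 \<and> int d - int k \<ge> 0) = (l * k \<le> c \<and> k \<le> d)" for k
      by (simp add: mult.commute flip: of_nat_mult)
    show ?thesis
      unfolding b_def eq
      by (rule le_Greatest_nat_iff[of _ d]) (auto intro: order.trans[OF mult_le_mono2])
  qed
  have b'_iff: "j \<le> b' \<longleftrightarrow> c1 - 1 + l * j \<le> c \<and> j \<le> d" if "c1 \<le> c" for j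
  proof -
    have "(int c - int k * int l \<ge> int c1 - 1 \<and> int d - int k \<ge> 0) =
        (c1 - 1 + l * k \<le> c \<and> k \<le> d)" for k
    proof -
      have "int (c1 - 1 + l * k) = int c1 - 1 + int k * int l"
        using pos(2) by (simp add: of_nat_diff)
      then have "int c1 - 1 \<le> int c - int k * int l \<longleftrightarrow> int (c1 - 1 + l * k) \<le> int c"
        by (simp only: le_diff_eq)
      then show ?thesis by (simp only: of_nat_le_iff diff_ge_0_iff_ge)
    qed
    then show ?thesis
      unfolding b'_def[OF that]
      using that by (simp only:) (rule le_Greatest_nat_iff[of _ d];
        auto intro: order.trans[OF add_left_mono[OF mult_le_mono2]])
  qed
  have "let K = real (code_dim (toric_code l \<alpha> N P));
           \<delta> = int (min_distance (toric_code l \<alpha> N P))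
       in
        (c < c1 \<and> b \<le> c2 - 1 \<longrightarrow>
           K = (real b + 1) * (real c + 1 - real b * real l / 2) \<and>
           \<delta> = int c2 * (int c1 - int c)) \<and>
        (c < c1 \<and> c2 - 1 < b \<longrightarrow>
           K = real c2 * (real c + 1 - (real c2 - 1) * real l / 2) \<and>
           \<delta> = int c2 * (int c1 - int c)) \<and>
        (c \<ge> c1 \<and> b' \<le> b \<and> b < c2 - 1 \<longrightarrow>
           K = real c1 * (real b' + 1) +
               (real b - real b') * (real c + 1 - real l * (real b + real b' + 1) / 2) \<and>
           \<delta> = int c2 - int b') \<and>
        (c \<ge> c1 \<and> b' < c2 - 1 \<and> c2 - 1 \<le> b \<longrightarrow>
           K = real c1 * (real b' + 1) +
               (real c2 - 1 - real b') * (real c + 1 - real l * (real c2 + real b') / 2) \<and>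
           \<delta> = int c2 - int b') \<and>
        (c \<ge> c1 \<and> b' \<ge> c2 - 1 \<longrightarrow>
           K = real c1 * real c2 \<and> \<delta> = 1)"
    if repY: "representatives l Y N P" for N and P :: "nat \<Rightarrow> 'a ^ 4"
  proof -
    define m where "m = min b (c2 - 1)"
    define K D where "K = code_dim (toric_code l \<alpha> N P)" and "D = min_distance (toric_code l \<alpha> N P)"
    note params = toric_code_parameters[OF pos assms(4-6) b_iff b'_iff repY[unfolded Y], folded \<alpha>_def]
    have K: "real K = real (\<Sum>j\<le>m. Suc (min (c - l * j) (c1 - 1)))"
      by (simp only: K_def m_def params(1))
    have D: "D = (if c < c1 then c2 * (c1 - c) else c2 - min b' (c2 - 1))"
      by (simp only: D_def params(2))
    have c2': "real (c2 - 1) = real c2 - 1"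
      using pos(3) by (simp add: of_nat_diff)
    have m_le: "l * j \<le> c" "j \<le> d" if "j \<le> m" for j
      using that b_iff[of j] by (simp_all add: m_def)
    have lt: "real K = (real m + 1) * (real c + 1 - real m * real l / 2) \<and> int D = int c2 * (int c1 - int c)"
      if "c < c1"
      using that dimension_lt[OF that m_le(1)] K D by (simp add: of_nat_diff)
    have ge: "real K = real c1 * (real p + 1) +
        (real m - real p) * (real c + 1 - real l * (real m + real p + 1) / 2)"
      if "c1 \<le> c" "p = min b' m" for p
    proof -
      have "c1 - 1 + l * j \<le> c" if "j \<le> p" for j
        using b'_iff[OF \<open>c1 \<le> c\<close>, of j] that \<open>p = min b' m\<close> by simp
      moreover have "l * j \<le> c \<and> c < c1 - 1 + l * j" if "p < j" "j \<le> m" for j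
        using b'_iff[OF \<open>c1 \<le> c\<close>, of j] m_le[OF that(2)] that \<open>p = min b' m\<close> by auto
      ultimately show ?thesis
        unfolding K using that pos(2) by (intro dimension_ge) simp_all
    qed
    have b'_le: "b' \<le> b" if "c1 \<le> c"
    proof -
      have "c1 - 1 + l * b' \<le> c" "b' \<le> d"
        using b'_iff[OF that, of b'] by simp_all
      then show ?thesis by (simp add: b_iff)
    qed
    have 1: "real K = (real b + 1) * (real c + 1 - real b * real l / 2) \<and>
        int D = int c2 * (int c1 - int c)" if "c < c1 \<and> b \<le> c2 - 1"
    proof -
      have "m = b" using that by (simp add: m_def)
      then show ?thesis using lt that by simp
    qed
    have 2: "real K = real c2 * (real c + 1 - (real c2 - 1) * real l / 2) \<and>
        int D = int c2 * (int c1 - int c)" if "c < c1 \<and> c2 - 1 < b"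
    proof -
      have "m = c2 - 1" using that by (simp add: m_def)
      then have "real m = real c2 - 1" by (simp only: c2')
      then show ?thesis using lt that by simp
    qed
    have 3: "real K = real c1 * (real b' + 1) +
          (real b - real b') * (real c + 1 - real l * (real b + real b' + 1) / 2) \<and>
        int D = int c2 - int b'" if "c \<ge> c1 \<and> b' \<le> b \<and> b < c2 - 1"
    proof -
      have "m = b" "b' = min b' m" using that by (simp_all add: m_def)
      moreover have "int (c2 - b') = int c2 - int b'"
        using that by (intro of_nat_diff) linarith
      ultimately show ?thesis using ge[of b'] that D by simp
    qed
    have 4: "real K = real c1 * (real b' + 1) +
          (real c2 - 1 - real b') * (real c + 1 - real l * (real c2 + real b') / 2) \<and>
        int D = int c2 - int b'" if "c \<ge> c1 \<and> b' < c2 - 1 \<and> c2 - 1 \<le> b"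
    proof -
      have m: "m = c2 - 1" "b' = min b' m" using that by (simp_all add: m_def)
      from m(1) have "real m = real c2 - 1" by (simp only: c2')
      moreover have "int (c2 - b') = int c2 - int b'"
        using that by (intro of_nat_diff) linarith
      ultimately show ?thesis using ge[OF _ m(2)] that D by simp
    qed
    have 5: "real K = real c1 * real c2 \<and> int D = 1" if "c \<ge> c1 \<and> b' \<ge> c2 - 1"
    proof -
      have "m = c2 - 1" "m = min b' m" using that b'_le by (simp_all add: m_def)
      then show ?thesis using ge[of m] that D pos(3) by (simp add: c2')
    qed
    show ?thesis
      unfolding Let_def K_def[symmetric] D_def[symmetric] using 1 2 3 4 5 by blast
  qed
  moreover have "subgroup Y (torus l)"
    unfolding Y by (rule subgroup_torus_coord_root_pairs)
  ultimately show ?thesis by blast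
qed

end
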